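(* A tree $T$ is well-ve-dominated if and only if $T\in\mathcal{T}_{\mathrm{wc}}\cup\{P_1,P_2\}$.
   Context: All graphs are finite, simple and undirected. A vertex $v$ ve-dominates an edge $e$ if at least one endpoint of $e$ belongs to the closed neighborhood $N_G[v]$. A set $D\subseteq V(G)$ is a ve-dominating set if every edge of $G$ is ve-dominated by some vertex of $D$; it is minimal if no proper subset is ve-dominating. $G$ is well-ve-dominated if all its minimal ve-dominating sets have the same cardinality. $P_n$ is the path on $n$ vertices. $\mathcal{T}_{\mathrm{wc}}$ is the family of trees obtained from $r\ge 1$ pairwise vertex-disjoint stars, each of order at least three, by adding $r-1$ edges between leaves of distinct stars so that the resulting graph is a tree and, for each original star, all added edges incident to that star meet the same selected leaf of that star. Membership in the family is understood up to isomorphism. *)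

theory Defs
  imports "Graph_Theory.Graph_Theory"
begin

text \<open>
  A finite simple undirected graph is a \<open>pair_graph\<close>: a finite loop-free symmetric digraph in
  which every undirected edge is represented by its two opposite arcs.

  The library predicate \<open>tree\<close> is unsuitable here, since it counts the closed walk of length two
  along an edge and back as a cycle. A cycle of an undirected graph is a library cycle of length at
  least three. \<open>Digraph_Component.connected\<close> includes nonemptiness.
\<close>

definition undirected_tree :: "'a pair_pre_digraph \<Rightarrow> bool" where
  "undirected_tree G \<longleftrightarrow> pair_graph G \<and> Digraph_Component.connected (with_proj G) \<and>
     \<not> (\<exists>p. pre_digraph.cycle (with_proj G) p \<and> 3 \<le> length p)"

definition closed_neighborhood :: "'a pair_pre_digraph \<Rightarrow> 'a \<Rightarrow> 'a set" where
  "closed_neighborhood G v = insert v {u. (v, u) \<in> parcs G}"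

definition ve_dominates :: "'a pair_pre_digraph \<Rightarrow> 'a \<Rightarrow> 'a \<times> 'a \<Rightarrow> bool" where
  "ve_dominates G v e \<longleftrightarrow> fst e \<in> closed_neighborhood G v \<or> snd e \<in> closed_neighborhood G v"

definition ve_dominating_set :: "'a pair_pre_digraph \<Rightarrow> 'a set \<Rightarrow> bool" where
  "ve_dominating_set G D \<longleftrightarrow> D \<subseteq> pverts G \<and> (\<forall>e \<in> parcs G. \<exists>v \<in> D. ve_dominates G v e)"

definition minimal_ve_dominating_set :: "'a pair_pre_digraph \<Rightarrow> 'a set \<Rightarrow> bool" where
  "minimal_ve_dominating_set G D \<longleftrightarrow>
     ve_dominating_set G D \<and> (\<forall>D'. D' \<subset> D \<longrightarrow> \<not> ve_dominating_set G D')"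

definition well_ve_dominated :: "'a pair_pre_digraph \<Rightarrow> bool" where
  "well_ve_dominated G \<longleftrightarrow>
     (\<forall>D D'. minimal_ve_dominating_set G D \<longrightarrow> minimal_ve_dominating_set G D' \<longrightarrow> card D = card D')"

definition path_graph :: "nat \<Rightarrow> nat pair_pre_digraph" where
  "path_graph n = \<lparr> pverts = {..<n}, parcs = {(i, j). i < n \<and> j < n \<and> (j = Suc i \<or> i = Suc j)} \<rparr>"

definition is_star :: "'a pair_pre_digraph \<Rightarrow> bool" where
  "is_star S \<longleftrightarrow> (\<exists>n. complete_bipartite_digraph 1 n (with_proj S))"

definition leaves :: "'a pair_pre_digraph \<Rightarrow> 'a set" where
  "leaves G = {v \<in> pverts G. out_degree (with_proj G) v = 1}"

text \<open>
  The stars are \<open>S 0, \<dots>, S (r - 1)\<close>, and \<open>F\<close> is the set of added edges, here as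
  unordered pairs so that \<open>card F\<close> counts undirected edges.
\<close>

definition T_wc :: "'a pair_pre_digraph set" where
  "T_wc = {G. \<exists>(r::nat) (S :: nat \<Rightarrow> 'a pair_pre_digraph) (F :: 'a set set).
     1 \<le> r \<and>
     (\<forall>i<r. is_star (S i) \<and> 3 \<le> card (pverts (S i))) \<and>
     (\<forall>i<r. \<forall>j<r. i \<noteq> j \<longrightarrow> pverts (S i) \<inter> pverts (S j) = {}) \<and>
     finite F \<and> card F = r - 1 \<and>
     (\<forall>e \<in> F. \<exists>i<r. \<exists>j<r. i \<noteq> j \<and> (\<exists>u \<in> leaves (S i). \<exists>v \<in> leaves (S j). e = {u, v})) \<and>
     (\<forall>i<r. \<exists>l \<in> leaves (S i). \<forall>e \<in> F. e \<inter> pverts (S i) \<noteq> {} \<longrightarrow> l \<in> e) \<and>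
     G = \<lparr> pverts = (\<Union>i<r. pverts (S i)), parcs = (\<Union>i<r. parcs (S i)) \<union> {(u, v). {u, v} \<in> F} \<rparr> \<and>
     undirected_tree G}"

end

theory Submission
  imports Defs
begin

text \<open>
  A vertex ve-dominates an edge \<open>uw\<close> exactly if it lies in \<open>N[u] \<union> N[w]\<close>, the neighbourhood of the
  edge. So the ve-dominating sets are the transversals of the hypergraph formed by all edge
  neighbourhoods, and a graph is well-ve-dominated if all minimal transversals have one size.

  On a tree this hypergraph satisfies a min-max equality: treating the edges from the deepest one
  upwards, a greedy choice produces a transversal together with at least as many pairwise disjoint
  edge neighbourhoods (\<open>packing_covering\<close>). In a well-ve-dominated tree the packing is therefore as
  large as every minimal transversal, so that every minimal transversal lies inside the union of
  the packed neighbourhoods and meets each of them exactly once (\<open>well_ve_dominated_packing\<close>).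
  From then on it suffices to exhibit minimal transversals through prescribed vertices, which
  \<open>ex_minimal_superset\<close> reduces to a local check:

  \<^item> Every vertex lies in some minimal transversal, so the packed neighbourhoods partition the
    vertices (\<open>ex_minimal_through\<close>).
  \<^item> On a path \<open>a, u, w, b\<close> some minimal transversal contains both \<open>a\<close> and \<open>b\<close>, so a packed edge
    \<open>uw\<close> has a leaf as one end, and its neighbourhood is a closed neighbourhood \<open>N[c]\<close>
    (\<open>ex_minimal_through_both_sides\<close>).
  \<^item> If two neighbours of \<open>c\<close> both have further neighbours, some minimal transversal contains both
    of them, so at most one neighbour of \<open>c\<close> is not a leaf (\<open>ex_minimal_through_two_branches\<close>).

  A tree on at least three vertices is thus partitioned into stars \<open>N[c]\<close>, each of which is joined
  to the rest at a single leaf: this is the family \<open>T_wc\<close>. Conversely, let such a partition be given.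
  An edge between a centre and an unlinked leaf has exactly one star as its neighbourhood, so every
  transversal meets every star. Any two vertices of a star dominate comparable sets of edges, so
  a minimal transversal meets each star only once, and its size is the number of stars.
\<close>

section \<open>Edge neighbourhoods and transversals\<close>

definition edge_nbhd :: "'a pair_pre_digraph \<Rightarrow> 'a \<times> 'a \<Rightarrow> 'a set" where
  "edge_nbhd G e = closed_neighborhood G (fst e) \<union> closed_neighborhood G (snd e)"

context pair_graph
begin

abbreviation N :: "'a \<Rightarrow> 'a set" where
  "N \<equiv> closed_neighborhood G"

abbreviation NE :: "'a \<times> 'a \<Rightarrow> 'a set" where
  "NE \<equiv> edge_nbhd G"

lemma in_N_iff: "u \<in> N v \<longleftrightarrow> u = v \<or> (v, u) \<in> parcs G"
  by (auto simp: closed_neighborhood_def)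

lemma N_sym: "u \<in> N v \<longleftrightarrow> v \<in> N u"
  using arcs_symmetric by (auto simp: in_N_iff)

lemma in_NE_iff: "x \<in> NE (u, v) \<longleftrightarrow> x \<in> N u \<or> x \<in> N v"
  by (simp add: edge_nbhd_def)

lemma N_subset: "v \<in> pverts G \<Longrightarrow> N v \<subseteq> pverts G"
  using wellformed' by (auto simp: in_N_iff)

lemma NE_subset: "e \<in> parcs G \<Longrightarrow> NE e \<subseteq> pverts G"
  using N_subset wellformed' by (cases e) (auto simp: edge_nbhd_def)

lemma ve_dominates_iff: "ve_dominates G v e \<longleftrightarrow> v \<in> NE e"
  using N_sym by (auto simp: ve_dominates_def edge_nbhd_def)

lemma ve_dominating_set_iff:
  "ve_dominating_set G D \<longleftrightarrow> D \<subseteq> pverts G \<and> (\<forall>e \<in> parcs G. D \<inter> NE e \<noteq> {})"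
  by (auto simp: ve_dominating_set_def ve_dominates_iff)

lemma ve_dominating_finite: "ve_dominating_set G D \<Longrightarrow> finite D"
  using finite_verts by (auto simp: ve_dominating_set_def intro: finite_subset)

lemma ex_minimal_subset:
  assumes "ve_dominating_set G D"
  obtains D' where "D' \<subseteq> D" "minimal_ve_dominating_set G D'"
proof -
  have "\<exists>D'\<subseteq>D. minimal_ve_dominating_set G D'"
    using ve_dominating_finite[OF assms] assms
  proof (induction D rule: finite_psubset_induct)
    case (psubset D)
    show ?case
    proof (cases "minimal_ve_dominating_set G D")
      case False
      then obtain D' where "D' \<subset> D" "ve_dominating_set G D'"
        using psubset.prems by (auto simp: minimal_ve_dominating_set_def)
      with psubset.IH show ?thesis by (meson psubset_imp_subset subset_trans)
    qed auto
  qed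
  with that show thesis by blast
qed

lemma minimal_no_redundant:
  assumes D: "minimal_ve_dominating_set G D" and xy: "x \<in> D" "y \<in> D" "x \<noteq> y"
    and red: "\<And>e. e \<in> parcs G \<Longrightarrow> x \<in> NE e \<Longrightarrow> y \<in> NE e"
  shows False
proof -
  have "(D - {x}) \<inter> NE e \<noteq> {}" if "e \<in> parcs G" for e
  proof -
    from D that obtain w where "w \<in> D" "w \<in> NE e"
      unfolding minimal_ve_dominating_set_def ve_dominating_set_iff by blast
    with xy red[OF that] show ?thesis by blast
  qed
  then have "ve_dominating_set G (D - {x})"
    using D unfolding minimal_ve_dominating_set_def ve_dominating_set_iff by blast
  moreover have "D - {x} \<subset> D" using xy by auto
  ultimately show False using D unfolding minimal_ve_dominating_set_def by blast
qed

text \<open>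
  Each \<open>x \<in> X\<close> is forced into the set by its own edge \<open>f x\<close>: it is the only vertex of \<open>X\<close> near \<open>f x\<close>,
  and all vertices near these edges other than those of \<open>X\<close> are given up. This is possible as long
  as no edge has its whole neighbourhood among the vertices given up.
\<close>

lemma ex_minimal_superset:
  assumes f: "\<And>x. x \<in> X \<Longrightarrow> f x \<in> parcs G" "\<And>x. x \<in> X \<Longrightarrow> NE (f x) \<inter> X = {x}"
    and avoid: "\<And>u w. (u, w) \<in> parcs G \<Longrightarrow> N u \<subseteq> (\<Union>x\<in>X. NE (f x)) - X \<Longrightarrow>
      N w \<subseteq> (\<Union>x\<in>X. NE (f x)) - X \<Longrightarrow> False"
  obtains D where "minimal_ve_dominating_set G D" "X \<subseteq> D"
proof -
  define A where "A = (\<Union>x\<in>X. NE (f x)) - X"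
  have "(pverts G - A) \<inter> NE e \<noteq> {}" if e: "e \<in> parcs G" for e
  proof -
    have "\<not> NE e \<subseteq> A"
    proof
      assume sub: "NE e \<subseteq> A"
      then have "N (fst e) \<subseteq> A" "N (snd e) \<subseteq> A" by (auto simp: edge_nbhd_def)
      with avoid[of "fst e" "snd e"] e show False by (simp add: A_def)
    qed
    with NE_subset[OF e] show ?thesis by blast
  qed
  then have "ve_dominating_set G (pverts G - A)" by (simp add: ve_dominating_set_iff)
  then obtain D where D: "D \<subseteq> pverts G - A" "minimal_ve_dominating_set G D"
    by (rule ex_minimal_subset)
  have "x \<in> D" if x: "x \<in> X" for x
  proof -
    have "D \<inter> NE (f x) \<noteq> {}"
      using D(2) f(1)[OF x] by (simp add: minimal_ve_dominating_set_def ve_dominating_set_iff)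
    then obtain y where "y \<in> D" "y \<in> NE (f x)" by blast
    moreover from this D(1) x have "y \<in> X" by (auto simp: A_def)
    ultimately show ?thesis using f(2)[OF x] by (metis IntI singletonD)
  qed
  then show thesis using that D(2) by blast
qed

end

section \<open>Rooted trees\<close>

context pair_graph
begin

text \<open>
  The parent function and the levels of a tree hung up at \<open>r\<close>; every edge joins a vertex to its
  parent. This is the form in which the arguments about dominating sets use acyclicity.
\<close>

definition rooting :: "'a \<Rightarrow> ('a \<Rightarrow> 'a) \<Rightarrow> ('a \<Rightarrow> nat) \<Rightarrow> bool" where
  "rooting r par lev \<longleftrightarrow> r \<in> pverts G \<and> lev r = 0 \<and>
     (\<forall>v \<in> pverts G - {r}. (v, par v) \<in> parcs G \<and> lev v = Suc (lev (par v))) \<and>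
     (\<forall>u v. (u, v) \<in> parcs G \<longrightarrow> v \<noteq> r \<and> u = par v \<or> u \<noteq> r \<and> v = par u)"

text \<open>
  A walk between two neighbours of \<open>v\<close> that avoids \<open>v\<close> closes up to a cycle through \<open>v\<close>. It has
  length at least three because the two neighbours are distinct.
\<close>

lemma no_two_paths:
  assumes acyclic: "\<not> (\<exists>p. cycle p \<and> 3 \<le> length p)"
    and arcs: "(v, u) \<in> parcs G" "(v, u') \<in> parcs G" and ne: "u \<noteq> u'"
    and p: "awalk u p u'" "v \<notin> set (awalk_verts u p)"
  shows False
proof -
  \<comment> \<open>a path along the walk, which still avoids \<open>v\<close>\<close>
  define q where "q = awalk_to_apath p"
  have q: "apath u q u'" unfolding q_def by (rule apath_awalk_to_apath[OF p(1)])
  then have aw: "awalk u q u'" and dist: "distinct (awalk_verts u q)" by (auto simp: apath_def)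
  have "set q \<subseteq> set p" unfolding q_def by (rule awalk_to_apath_subset[OF p(1)])
  then have vq: "v \<notin> set (awalk_verts u q)"
    using p set_awalk_verts[OF aw] set_awalk_verts[OF p(1)] by auto
  have "q \<noteq> []" using aw ne by (auto simp: awalk_Nil_iff)
  let ?c = "(v, u) # q @ [(u', v)]"
  have u'v: "(u', v) \<in> parcs G" using arcs arcs_symmetric by blast
  have closing: "awalk u' [(u', v)] v" using u'v by (auto simp: awalk_simps wellformed')
  have aw2: "awalk u (q @ [(u', v)]) v" by (rule awalk_appendI[OF aw closing])
  then have "awalk v ?c v" using arcs by (auto simp: awalk_Cons_iff)
  moreover have "awalk_verts u (q @ [(u', v)]) = awalk_verts u q @ [v]"
    using awalk_verts_append[OF aw2] aw by auto
  then have "distinct (tl (awalk_verts v ?c))" using dist vq by simp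
  ultimately have "cycle ?c" unfolding cycle_def by blast
  moreover have "3 \<le> length ?c" using \<open>q \<noteq> []\<close> by (cases q) auto
  ultimately show False using acyclic by blast
qed

text \<open>
  The levels are the distances to \<open>r\<close>. Shortest walks to \<open>r\<close> from two neighbours of \<open>v\<close> that are not
  farther away than \<open>v\<close> both avoid \<open>v\<close>, so by acyclicity \<open>v\<close> has only one such neighbour.
\<close>

lemma ex_rooting:
  assumes conn: "Digraph_Component.connected (with_proj G)"
    and acyclic: "\<not> (\<exists>p. cycle p \<and> 3 \<le> length p)"
    and r: "r \<in> pverts G"
  obtains par lev where "rooting r par lev"
proof -
  have reach: "\<exists>p. awalk v p r" if "v \<in> pverts G" for v
  proof -
    have "strongly_connected (with_proj G)"
      using conn pair_sym_arcs by (intro symmetric_connected_imp_strongly_connected)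
    then have "v \<rightarrow>\<^sup>*\<^bsub>with_proj G\<^esub> r" using that r by (auto simp: strongly_connected_def)
    then show ?thesis by (simp add: reachable_awalk)
  qed
  define lev where "lev v = (LEAST n. \<exists>p. awalk v p r \<and> length p = n)" for v
  have lev_le: "lev v \<le> length p" if "awalk v p r" for v p
    unfolding lev_def using that by (auto intro: Least_le)
  have lev_ex: "\<exists>p. awalk v p r \<and> length p = lev v" if "v \<in> pverts G" for v
  proof -
    have "\<exists>n p. awalk v p r \<and> length p = n" using reach[OF that] by blast
    from LeastI_ex[OF this] show ?thesis unfolding lev_def .
  qed
  have lev_r: "lev r = 0" using lev_le[of r "[]"] r by (simp add: awalk_Nil_iff)
  have down: "\<exists>u. (v, u) \<in> parcs G \<and> lev v = Suc (lev u)" if v: "v \<in> pverts G" "v \<noteq> r" for v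
  proof -
    obtain p where p: "awalk v p r" "length p = lev v" using lev_ex[OF v(1)] by blast
    then obtain e es where es: "p = e # es" using v by (cases p) (auto simp: awalk_Nil_iff)
    then have e: "e \<in> parcs G" "v = fst e" "awalk (snd e) es r" using p by (auto simp: awalk_Cons_iff)
    then have "lev (snd e) \<le> length es" by (intro lev_le)
    moreover obtain q where q: "awalk (snd e) q r" "length q = lev (snd e)"
      using lev_ex[of "snd e"] e by auto
    have "lev v \<le> length (e # q)" using e q by (intro lev_le) (auto simp: awalk_Cons_iff)
    ultimately show ?thesis using p es e q by (intro exI[of _ "snd e"]) auto
  qed
  have shortest: "\<exists>p. awalk v p r \<and> (\<forall>w \<in> set (awalk_verts v p). w = v \<or> lev w < lev v)"
    if "v \<in> pverts G" for v
    using that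
  proof (induction "lev v" arbitrary: v rule: less_induct)
    case less
    show ?case
    proof (cases "v = r")
      case True
      then show ?thesis using r by (intro exI[of _ "[]"]) (auto simp: awalk_Nil_iff)
    next
      case False
      then obtain u where u: "(v, u) \<in> parcs G" "lev v = Suc (lev u)" using down less.prems by blast
      then obtain p where "awalk u p r" "\<forall>w \<in> set (awalk_verts u p). w = u \<or> lev w < lev u"
        using less.hyps[of u] wellformed' by auto
      with u show ?thesis by (intro exI[of _ "(v, u) # p"]) (auto simp: awalk_Cons_iff)
    qed
  qed
  have unique: False
    if a: "(v, u) \<in> parcs G" "(v, u') \<in> parcs G" "u \<noteq> u'" "lev u \<le> lev v" "lev u' \<le> lev v" for v u u'
  proof -
    obtain p where p: "awalk u p r" "\<forall>w \<in> set (awalk_verts u p). w = u \<or> lev w < lev u"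
      using shortest[of u] a wellformed' by blast
    obtain p' where p': "awalk u' p' r" "\<forall>w \<in> set (awalk_verts u' p'). w = u' \<or> lev w < lev u'"
      using shortest[of u'] a wellformed' by blast
    have rev: "awalk r (rev_path p') u'" using p' by simp
    have aw: "awalk u (p @ rev_path p') u'" by (rule awalk_appendI[OF p(1) rev])
    have "set (awalk_verts u (p @ rev_path p')) = set (awalk_verts u p) \<union> set (awalk_verts u' p')"
      using set_awalk_verts_append[OF p(1) rev] awalk_verts_rev_path[OF p'(1)] by simp
    moreover have "v \<noteq> u" "v \<noteq> u'" using a no_loops' by blast+
    ultimately have "v \<notin> set (awalk_verts u (p @ rev_path p'))" using p p' a by fastforce
    with no_two_paths[OF acyclic a(1,2,3) aw] show False by blast
  qed
  define par where "par v = (SOME u. (v, u) \<in> parcs G \<and> lev v = Suc (lev u))" for v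
  have par: "(v, par v) \<in> parcs G \<and> lev v = Suc (lev (par v))" if "v \<in> pverts G" "v \<noteq> r" for v
    unfolding par_def using down[OF that] by (rule someI_ex)
  have oriented: "v \<noteq> r \<and> u = par v" if uv: "(u, v) \<in> parcs G" "lev u \<le> lev v" for u v
  proof -
    have vr: "v \<noteq> r"
    proof
      assume "v = r"
      then have "lev u = 0" using uv lev_r by simp
      moreover have "u \<noteq> r" using uv \<open>v = r\<close> no_loops' by blast
      ultimately show False using down[of u] uv wellformed' by force
    qed
    moreover have "u = par v"
      using unique[of v u "par v"] par[of v] vr uv wellformed' arcs_symmetric by fastforce
    ultimately show ?thesis by blast
  qed
  have "rooting r par lev"
    unfolding rooting_def using r lev_r par oriented arcs_symmetric by (metis DiffE nle_le singletonI)
  then show thesis by (rule that)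
qed

lemma rooting_arcD:
  assumes "rooting r par lev" "(u, v) \<in> parcs G"
  shows "v \<noteq> r \<and> u = par v \<and> lev v = Suc (lev u) \<or> u \<noteq> r \<and> v = par u \<and> lev u = Suc (lev v)"
  using assms wellformed' unfolding rooting_def by blast

lemma rooting_parD:
  assumes "rooting r par lev" "v \<in> pverts G" "v \<noteq> r"
  shows "(v, par v) \<in> parcs G" "(par v, v) \<in> parcs G" "par v \<in> pverts G" "lev v = Suc (lev (par v))"
  using assms wellformed' arcs_symmetric unfolding rooting_def by blast+

lemma rooting_ND:
  assumes "rooting r par lev" "x \<in> N v"
  shows "x = v \<or> v \<noteq> r \<and> x = par v \<and> lev v = Suc (lev x) \<or> x \<noteq> r \<and> par x = v \<and> lev x = Suc (lev v)"
  using assms rooting_arcD[OF assms(1), of v x] unfolding in_N_iff by blast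

lemma rooting_childD:
  assumes "rooting r par lev" "(u, v) \<in> parcs G" "u = r \<or> v \<noteq> par u"
  shows "par v = u" "v \<noteq> r" "lev v = Suc (lev u)"
  using assms(3) rooting_arcD[OF assms(1,2)] by metis+

text \<open>
  The reason for the min-max equality: let \<open>p\<close> be the lower end of an edge that lies at least as
  deep as another edge, with lower end \<open>q\<close>. If the two edge neighbourhoods meet at all, then the
  grandparent of \<open>p\<close> already lies in the neighbourhood of the other edge. If \<open>p\<close> is a child of the
  root, the root takes the part of the grandparent.
\<close>

lemma deepest_edge_nbhd_meets:
  assumes root: "rooting r par lev"
    and arcs: "(par p, p) \<in> parcs G" "(par q, q) \<in> parcs G" and child: "p \<noteq> r" "q \<noteq> r"
    and deepest: "lev q \<le> lev p"
    and x: "x \<in> NE (par p, p)" "x \<in> NE (par q, q)"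
  shows "(if par p = r then r else par (par p)) \<in> NE (par q, q)"
proof -
  define c d where "c = par p" and "d = par q"
  define m where "m = (if c = r then r else par c)"
  have verts: "p \<in> pverts G" "q \<in> pverts G"
    using arcs wellformed' by blast+
  have lev: "lev p = Suc (lev c)" "lev q = Suc (lev d)"
    using rooting_parD(4)[OF root] verts child unfolding c_def d_def by blast+
  have dN: "d \<in> NE (d, q)" "q \<in> NE (d, q)" by (auto simp: in_NE_iff in_N_iff)
  have dV: "d \<in> pverts G" using arcs(2) wellformed' unfolding d_def by blast
  have top: "m \<in> NE (d, q)" if "c = d"
  proof (cases "d = r")
    case False
    then have "(d, par d) \<in> parcs G" using rooting_parD(1)[OF root dV] by blast
    with that False show ?thesis by (simp add: m_def in_NE_iff in_N_iff)
  qed (use that dN in \<open>simp add: m_def\<close>)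
  have par: "par p = c" "par q = d" by (simp_all add: c_def d_def)
  note x' = x[unfolded par in_NE_iff]
  have "x = c \<or> c \<noteq> r \<and> x = par c \<or> x \<noteq> r \<and> par x = c \<and> lev x = lev p \<or> par x = p \<and> lev x = Suc (lev p)"
    using x'(1) rooting_ND[OF root, of x c] rooting_ND[OF root, of x p] lev(1) child(1) par(1) by metis
  moreover have "x = d \<or> d \<noteq> r \<and> x = par d \<and> lev d = Suc (lev x) \<or>
      x \<noteq> r \<and> par x = d \<and> lev x = lev q \<or> x \<noteq> r \<and> par x = q \<and> lev x = Suc (lev q)"
    using x'(2) rooting_ND[OF root, of x d] rooting_ND[OF root, of x q] lev(2) child(2) par(2) by metis
  \<comment> \<open>the levels of \<open>x\<close> rule out all other combinations\<close>
  ultimately have "c = d \<or> m = x \<or> m = d \<or> m = q"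
    unfolding m_def using deepest lev child par
    by (elim disjE conjE) (metis Suc_n_not_le_n Suc_le_mono le_SucI nat.inject le_refl)+
  then have "m \<in> NE (d, q)" using top dN x(2) unfolding par by metis
  then show ?thesis by (simp only: m_def par)
qed

text \<open>
  Induction on \<open>E\<close>: choose a deepest edge \<open>e\<close>, let the grandparent \<open>m\<close> of its lower end join the
  transversal, and let \<open>e\<close> join the packing. The edges that \<open>m\<close> does not dominate have neighbourhoods
  disjoint from that of \<open>e\<close>, and the induction hypothesis applies to them.
\<close>

lemma packing_covering:
  assumes root: "rooting r par lev" and "E \<subseteq> parcs G"
  shows "\<exists>D P. D \<subseteq> pverts G \<and> P \<subseteq> E \<and> (\<forall>e \<in> E. D \<inter> NE e \<noteq> {}) \<and>
    disjoint_family_on NE P \<and> card D \<le> card P"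
proof -
  have "finite E" using assms(2) finite_arcs by (rule finite_subset)
  then show ?thesis using assms(2)
  proof (induction E rule: finite_psubset_induct)
    case (psubset E)
    show ?case
    proof (cases "E = {}")
      case True
      then show ?thesis by (intro exI[of _ "{}"]) (auto simp: disjoint_family_on_def)
    next
      case False
      \<comment> \<open>arcs occur in both directions; \<open>child e\<close> is the lower end\<close>
      define child where "child e = (if snd e \<noteq> r \<and> fst e = par (snd e) then snd e else fst e)" for e
      have child: "child e \<noteq> r \<and> (par (child e), child e) \<in> parcs G \<and> NE e = NE (par (child e), child e)"
        if "e \<in> E" for e
      proof (cases e)
        case (Pair u v)
        then have uv: "(u, v) \<in> parcs G" using that psubset.prems by blast
        then have "v \<noteq> r \<and> u = par v \<or> u \<noteq> r \<and> v = par u"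
          using rooting_arcD[OF root] by blast
        moreover have "NE (u, v) = NE (v, u)" by (auto simp: edge_nbhd_def)
        moreover have "(v, u) \<in> parcs G" using uv arcs_symmetric by blast
        ultimately show ?thesis using uv Pair by (auto simp: child_def)
      qed
      obtain e where e: "e \<in> E" "\<And>f. f \<in> E \<Longrightarrow> lev (child f) \<le> lev (child e)"
      proof -
        let ?h = "\<lambda>f. lev (child f)"
        have "Max (?h ` E) \<in> ?h ` E" using psubset.hyps False by (intro Max_in) auto
        then obtain e where "e \<in> E" "?h e = Max (?h ` E)" by auto
        moreover have "?h f \<le> Max (?h ` E)" if "f \<in> E" for f
          using psubset.hyps that by (intro Max_ge) auto
        ultimately show thesis using that by simp
      qed
      define m where "m = (if par (child e) = r then r else par (par (child e)))"
      have e': "(par (child e), child e) \<in> parcs G" "child e \<noteq> r" using child[OF e(1)] by blast+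
      then have pv: "par (child e) \<in> pverts G" using wellformed' by blast
      have m: "m \<in> pverts G" "m \<in> NE e"
        using rooting_parD[OF root pv] pv child[OF e(1)] by (auto simp: m_def in_NE_iff in_N_iff)
      define E' where "E' = {f \<in> E. m \<notin> NE f}"
      have sub: "E' \<subset> E" using e(1) m by (auto simp: E'_def)
      then obtain D P where DP: "D \<subseteq> pverts G" "P \<subseteq> E'" "\<forall>e \<in> E'. D \<inter> NE e \<noteq> {}"
          "disjoint_family_on NE P" "card D \<le> card P"
        using psubset.IH[OF sub] subset_trans[OF psubset_imp_subset[OF sub] psubset.prems] by blast
      have fin: "finite D" "finite P"
        using DP finite_verts psubset.hyps sub by (meson finite_subset psubset_imp_subset)+
      have disj: "NE f \<inter> NE e = {}" if "f \<in> P" for f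
      proof -
        have f: "f \<in> E" "m \<notin> NE f" using that DP(2) by (auto simp: E'_def)
        note meets = deepest_edge_nbhd_meets[OF root _ _ _ _ e(2)[OF f(1)], folded m_def]
        show ?thesis
        proof (rule ccontr)
          assume "NE f \<inter> NE e \<noteq> {}"
          then obtain x where "x \<in> NE f" "x \<in> NE e" by blast
          then have "m \<in> NE f" using child[OF f(1)] child[OF e(1)] meets[of x] by simp
          with f(2) show False by blast
        qed
      qed
      have "e \<notin> P" using DP(2) m by (auto simp: E'_def)
      then have "card (insert m D) \<le> card (insert e P)" using fin DP(5) by (simp add: card_insert_if)
      moreover have "disjoint_family_on NE (insert e P)"
        using DP(4) disj by (fastforce simp: disjoint_family_on_def)
      moreover have "insert m D \<subseteq> pverts G" "insert e P \<subseteq> E" using DP m e sub by auto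
      moreover have "insert m D \<inter> NE f \<noteq> {}" if "f \<in> E" for f
        using DP(3) that unfolding E'_def by blast
      ultimately show ?thesis by (intro exI[of _ "insert m D"] exI[of _ "insert e P"] conjI ballI)
    qed
  qed
qed

end

locale tree_graph = pair_graph +
  assumes tree: "undirected_tree G"
begin

lemma tree_rooting:
  assumes "r \<in> pverts G"
  obtains par lev where "rooting r par lev"
  using ex_rooting[OF _ _ assms] tree that unfolding undirected_tree_def by blast

lemma verts_nonempty: "pverts G \<noteq> {}"
  using tree by (auto simp: undirected_tree_def Digraph_Component.connected_conv)

text \<open>
  A minimal set \<open>D\<close> needs a vertex in each packed neighbourhood; these are distinct by disjointness.
  As \<open>D\<close> is not larger than the packing, there is nothing left in \<open>D\<close> beyond these vertices.
\<close>

lemma well_ve_dominated_packing: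
  assumes well: "well_ve_dominated G"
  obtains P where "P \<subseteq> parcs G" "disjoint_family_on NE P"
    "\<And>D. minimal_ve_dominating_set G D \<Longrightarrow> D \<subseteq> (\<Union>e\<in>P. NE e) \<and> (\<forall>e\<in>P. card (D \<inter> NE e) = 1)"
proof -
  obtain r where "r \<in> pverts G" using verts_nonempty by blast
  then obtain par lev where "rooting r par lev" by (rule tree_rooting)
  from packing_covering[OF this subset_refl] obtain T P where
    T: "T \<subseteq> pverts G" "\<forall>e \<in> parcs G. T \<inter> NE e \<noteq> {}" and
    P: "P \<subseteq> parcs G" "disjoint_family_on NE P" and card: "card T \<le> card P" by blast
  have "ve_dominating_set G T" using T by (simp add: ve_dominating_set_iff)
  then obtain D0 where D0: "D0 \<subseteq> T" "minimal_ve_dominating_set G D0" by (rule ex_minimal_subset)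
  have "card D0 \<le> card T" using D0 T finite_verts by (meson card_mono finite_subset)
  with card have le: "card D0 \<le> card P" by simp
  show thesis
  proof (rule that[OF P])
    fix D assume D: "minimal_ve_dominating_set G D"
    then have "card D = card D0" using well D0 unfolding well_ve_dominated_def by blast
    with le have DP: "card D \<le> card P" by simp
    have finD: "finite D" using D ve_dominating_finite by (auto simp: minimal_ve_dominating_set_def)
    have "\<forall>e\<in>P. \<exists>x. x \<in> D \<inter> NE e"
      using D P(1) unfolding minimal_ve_dominating_set_def ve_dominating_set_iff by blast
    then obtain g where g: "\<And>e. e \<in> P \<Longrightarrow> g e \<in> D \<inter> NE e" by metis
    have "inj_on g P"
      using g P(2) by (fastforce simp: inj_on_def disjoint_family_on_def)
    then have "card (g ` P) = card P" by (rule card_image)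
    with DP g finD have img: "g ` P = D" by (intro card_seteq) auto
    have "D \<inter> NE e = {g e}" if "e \<in> P" for e
    proof -
      have "x = g e" if x: "x \<in> D" "x \<in> NE e" for x
      proof -
        obtain f where f: "f \<in> P" "x = g f" using img x by blast
        have "f = e"
        proof (rule ccontr)
          assume "f \<noteq> e"
          then have "NE f \<inter> NE e = {}" using P(2) f(1) \<open>e \<in> P\<close> by (simp add: disjoint_family_on_def)
          with g[OF f(1)] f(2) x show False by blast
        qed
        with f show ?thesis by simp
      qed
      with g[OF that] show ?thesis by blast
    qed
    then show "D \<subseteq> (\<Union>e\<in>P. NE e) \<and> (\<forall>e\<in>P. card (D \<inter> NE e) = 1)"
      using img g by auto
  qed
qed

text \<open>
  The vertex \<open>v\<close> is forced by an edge \<open>vy\<close>. With the tree hung up at \<open>v\<close>, both ends of an edge whose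
  neighbourhood is given up would be children of \<open>y\<close>, but children of \<open>y\<close> are not adjacent.
\<close>

lemma ex_minimal_through:
  assumes vy: "(v, y) \<in> parcs G"
  obtains D where "minimal_ve_dominating_set G D" "v \<in> D"
proof -
  have v: "v \<in> pverts G" using vy wellformed' by blast
  obtain par lev where root: "rooting v par lev" using tree_rooting[OF v] .
  have vN: "v \<in> N v" "v \<in> N y" using vy arcs_symmetric by (auto simp: in_N_iff)
  have child: "par x = y \<and> x \<noteq> y \<and> x \<noteq> v" if "N x \<subseteq> NE (v, y) - {v}" for x
  proof -
    have "v \<notin> N x" "x \<in> NE (v, y) - {v}" using that by (auto simp: in_N_iff)
    then have "x \<in> N y" "x \<noteq> v" "x \<noteq> y" using N_sym vN by (auto simp: in_NE_iff)
    moreover have "par y = v" using rooting_arcD[OF root vy] by auto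
    ultimately show ?thesis using rooting_arcD[OF root, of y x] by (auto simp: in_N_iff)
  qed
  obtain D where "minimal_ve_dominating_set G D" "{v} \<subseteq> D"
  proof (rule ex_minimal_superset[of "{v}" "\<lambda>_. (v, y)"])
    fix u w assume uw: "(u, w) \<in> parcs G"
      and "N u \<subseteq> (\<Union>x\<in>{v}. NE (v, y)) - {v}" "N w \<subseteq> (\<Union>x\<in>{v}. NE (v, y)) - {v}"
    with child[of u] child[of w] rooting_arcD[OF root uw] show False by auto
  qed (use vy vN in \<open>auto simp: in_NE_iff\<close>)
  with that show thesis by blast
qed

text \<open>
  The edges \<open>au\<close> and \<open>wb\<close> force \<open>a\<close> and \<open>b\<close>. With the tree hung up at \<open>u\<close>, both ends of an edge whose
  neighbourhood is given up would be children of \<open>u\<close> or \<open>w\<close> other than \<open>w\<close>, and no two of these are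
  adjacent.
\<close>

lemma ex_minimal_through_both_sides:
  assumes arcs: "(a, u) \<in> parcs G" "(u, w) \<in> parcs G" "(w, b) \<in> parcs G" and ne: "a \<noteq> w" "b \<noteq> u"
  obtains D where "minimal_ve_dominating_set G D" "a \<in> D" "b \<in> D" "a \<noteq> b"
proof -
  have u: "u \<in> pverts G" using arcs wellformed' by blast
  obtain par lev where root: "rooting u par lev" using tree_rooting[OF u] .
  have par: "par a = u" "par w = u" "par b = w" "lev a = 1" "lev w = 1" "lev b = 2" "lev u = 0"
    using rooting_arcD[OF root arcs(1)] rooting_arcD[OF root arcs(2)] rooting_arcD[OF root arcs(3)]
      ne root by (auto simp: rooting_def)
  have "a \<noteq> u" "w \<noteq> u" "b \<noteq> w" "a \<noteq> b" using arcs no_loops' par by force+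
  have priv: "b \<notin> N a" "b \<notin> N u" "a \<notin> N w" "a \<notin> N b"
    using par ne \<open>a \<noteq> b\<close> rooting_arcD[OF root, of a b] rooting_arcD[OF root, of u b]
      rooting_arcD[OF root, of w a] rooting_arcD[OF root, of b a] by (auto simp: in_N_iff)
  \<comment> \<open>the edge that forces each of the two vertices\<close>
  let ?f = "\<lambda>x. if x = a then (a, u) else (w, b)"
  have inN: "a \<in> N u" "b \<in> N w" using arcs arcs_symmetric by (auto simp: in_N_iff)
  have child: "par x \<in> {u, w} \<and> x \<noteq> u \<and> x \<noteq> w" if "N x \<subseteq> (\<Union>x\<in>{a, b}. NE (?f x)) - {a, b}" for x
  proof -
    have ab: "a \<notin> N x" "b \<notin> N x" and "x \<in> N x" using that by (auto simp: in_N_iff)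
    then have "x \<in> N a \<or> x \<in> N u \<or> x \<in> N w \<or> x \<in> N b"
      using that by (auto simp: edge_nbhd_def split: if_splits)
    then have "x \<in> N u \<or> x \<in> N w" "x \<noteq> u" "x \<noteq> w" using ab N_sym inN by blast+
    then show ?thesis using rooting_arcD[OF root, of u x] rooting_arcD[OF root, of w x] par
      by (auto simp: in_N_iff)
  qed
  obtain D where "minimal_ve_dominating_set G D" "{a, b} \<subseteq> D"
  proof (rule ex_minimal_superset[of "{a, b}" ?f])
    fix x y assume xy: "(x, y) \<in> parcs G"
      and sub: "N x \<subseteq> (\<Union>x\<in>{a, b}. NE (?f x)) - {a, b}" "N y \<subseteq> (\<Union>x\<in>{a, b}. NE (?f x)) - {a, b}"
    from child[OF sub(1)] child[OF sub(2)] rooting_arcD[OF root xy] show False by auto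
  qed (use arcs priv \<open>a \<noteq> b\<close> in \<open>auto simp: in_NE_iff in_N_iff\<close>)
  with that \<open>a \<noteq> b\<close> show thesis by blast
qed

lemma ex_neighbour:
  assumes "v \<in> pverts G" "2 \<le> card (pverts G)"
  obtains y where "(v, y) \<in> parcs G"
proof -
  have "\<not> pverts G \<subseteq> {v}" using assms(2) card_mono[of "{v}" "pverts G"] by auto
  then obtain r where r: "r \<in> pverts G" "r \<noteq> v" by blast
  obtain par lev where "rooting r par lev" using tree_rooting[OF r(1)] .
  from rooting_parD(1)[OF this assms(1)] r that show thesis by blast
qed

text \<open>
  If \<open>c\<close> and \<open>p\<close> have no neighbours besides each other, connectedness leaves no room for further
  vertices.
\<close>

lemma isolated_edge_is_all:
  assumes c: "c \<in> pverts G" and N: "N p = {c, p}" "N c = {c, p}"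
  shows "pverts G \<subseteq> {c, p}"
proof
  obtain par lev where root: "rooting c par lev" using tree_rooting[OF c] .
  fix v assume "v \<in> pverts G"
  then show "v \<in> {c, p}"
  proof (induction "lev v" arbitrary: v rule: less_induct)
    case less
    show ?case
    proof (cases "v = c")
      case False
      note par = rooting_parD[OF root less.prems False]
      then have "par v \<in> {c, p}" using less.hyps[of "par v"] by simp
      moreover have "v \<in> N (par v)" using par by (simp add: in_N_iff)
      ultimately show ?thesis using N by auto
    qed simp
  qed
qed

text \<open>
  Here the closed neighbourhoods of the vertices in \<open>C\<close> partition the tree and each vertex of \<open>C\<close> has
  a leaf attached. The edges \<open>yz\<close> and \<open>y'z'\<close> force \<open>y\<close> and \<open>y'\<close>. Hang up the tree at \<open>c\<close>. If \<open>N[u]\<close> is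
  given up, then so is the vertex of \<open>C\<close> that dominates \<open>u\<close>; it can only be \<open>c\<close> or a child of \<open>z\<close> or
  \<open>z'\<close>, and turns out to be the parent of \<open>u\<close>. Moreover \<open>u\<close> is not in \<open>C\<close>, since the leaf at \<open>u\<close>
  would have to be given up, too. Hence no two such vertices \<open>u\<close> are adjacent.
\<close>

lemma ex_minimal_through_two_branches:
  assumes unique: "\<And>c c' v. c \<in> C \<Longrightarrow> c' \<in> C \<Longrightarrow> v \<in> N c \<Longrightarrow> v \<in> N c' \<Longrightarrow> c = c'"
    and cover: "\<And>v. v \<in> pverts G \<Longrightarrow> \<exists>c\<in>C. v \<in> N c"
    and leaf: "\<And>c. c \<in> C \<Longrightarrow> \<exists>p. p \<noteq> c \<and> N p = {c, p}"
    and c: "c \<in> C" and ne: "y \<noteq> y'" "z \<noteq> c" "z' \<noteq> c"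
    and arcs: "(c, y) \<in> parcs G" "(y, z) \<in> parcs G" "(c, y') \<in> parcs G" "(y', z') \<in> parcs G"
  obtains D where "minimal_ve_dominating_set G D" "y \<in> D" "y' \<in> D"
proof -
  have cV: "c \<in> pverts G" using arcs wellformed' by blast
  obtain par lev where root: "rooting c par lev" using tree_rooting[OF cV] .
  note par_c = rooting_childD[OF root arcs(1)] rooting_childD[OF root arcs(3)]
  have par: "par y = c" "y \<noteq> c" "par y' = c" "y' \<noteq> c" "par z = y" "par z' = y'"
    using par_c rooting_childD(1)[OF root arcs(2)] rooting_childD(1)[OF root arcs(4)] ne by auto
  \<comment> \<open>the edge that forces each of the two vertices\<close>
  let ?f = "\<lambda>x. if x = y then (y, z) else (y', z')"
  define A where "A = (\<Union>x\<in>{y, y'}. NE (?f x)) - {y, y'}"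
  have A: "A = N y \<union> N z \<union> N y' \<union> N z' - {y, y'}" using ne by (auto simp: A_def edge_nbhd_def)
  have branch: "par u = s"
    if u: "N u \<subseteq> A" "u \<notin> C" and s: "s \<in> C" "u \<in> N s"
      and sx: "s \<in> N x \<union> N t" and x: "(c, x) \<in> parcs G" "(x, t) \<in> parcs G" "t \<noteq> c" "x \<in> {y, y'}"
    for u s x t
  proof -
    have xu: "x \<notin> N u" "x \<noteq> u" using u x(4) by (auto simp: A in_N_iff)
    have xc: "x \<in> N c" "x \<in> N t" "t \<in> N x" using x arcs_symmetric by (auto simp: in_N_iff)
    have us: "(s, u) \<in> parcs G" using s u(2) by (auto simp: in_N_iff)
    show ?thesis
    proof (cases "s = c")
      case True
      then show ?thesis using rooting_arcD[OF root us] by blast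
    next
      case False
      then have "x \<notin> N s" using unique[OF s(1) c] xc by blast
      then have "s \<notin> N x" "s \<noteq> t" using N_sym xc by blast+
      then have ts: "(t, s) \<in> parcs G" using sx by (auto simp: in_N_iff)
      have "par t = x"
        using rooting_childD(1)[OF root x(1)] rooting_childD(1)[OF root x(2)] x(3) by simp
      then have "par s = t"
        using rooting_childD(1)[OF root ts] \<open>x \<notin> N s\<close> by (auto simp: in_N_iff)
      moreover have "t \<noteq> u" using xu xc N_sym by blast
      ultimately show ?thesis using rooting_childD(1)[OF root us] by metis
    qed
  qed
  have child: "u \<notin> C \<and> par u \<in> C" if u: "N u \<subseteq> A" for u
  proof -
    have yu: "y \<notin> N u" "y' \<notin> N u" "u \<in> N u" using u by (auto simp: A in_N_iff)
    have uV: "u \<in> pverts G"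
      using yu(3) u arcs wellformed' N_subset unfolding A by blast
    have "u \<notin> C"
    proof
      assume "u \<in> C"
      then obtain p where p: "p \<noteq> u" "N p = {u, p}" using leaf by blast
      then have "p \<in> A" using u N_sym[of p u] by auto
      then have "p \<notin> {y, y'}" "p \<in> N y \<union> N z \<union> N y' \<union> N z'" by (auto simp: A)
      then have "z \<in> N p \<or> z' \<in> N p \<or> y \<in> N p \<or> y' \<in> N p" using N_sym by blast
      moreover have "y \<in> N z" "y' \<in> N z'" using arcs arcs_symmetric by (auto simp: in_N_iff)
      ultimately show False using p yu \<open>p \<notin> {y, y'}\<close> by auto
    qed
    moreover obtain s where s: "s \<in> C" "u \<in> N s" using cover[OF uV] by blast
    moreover from s have "s \<in> A" using N_sym u by blast
    then have "s \<in> N y \<union> N z \<or> s \<in> N y' \<union> N z'" by (auto simp: A)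
    then have "par u = s"
      using branch[OF u \<open>u \<notin> C\<close> s _ arcs(1,2) ne(2)] branch[OF u \<open>u \<notin> C\<close> s _ arcs(3,4) ne(3)] by blast
    ultimately show ?thesis by blast
  qed
  have priv: "y' \<notin> N y" "y' \<notin> N z" "y \<notin> N y'" "y \<notin> N z'"
    using par ne rooting_arcD[OF root, of y y'] rooting_arcD[OF root, of z y']
      rooting_arcD[OF root, of y' y] rooting_arcD[OF root, of z' y] unfolding in_N_iff by metis+
  obtain D where "minimal_ve_dominating_set G D" "{y, y'} \<subseteq> D"
  proof (rule ex_minimal_superset[of "{y, y'}" ?f, folded A_def])
    fix u w assume uw: "(u, w) \<in> parcs G" and sub: "N u \<subseteq> A" "N w \<subseteq> A"
    from child[OF sub(1)] child[OF sub(2)] rooting_arcD[OF root uw] show False by auto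
  qed (use arcs priv ne in \<open>auto simp: in_NE_iff in_N_iff\<close>)
  with that show thesis by blast
qed

end

section \<open>Partitions into stars\<close>

text \<open>
  The vertices in \<open>C\<close> are the centres. In each star all vertices except the centre and one
  distinguished vertex \<open>l\<close> are leaves of the whole graph, so that only \<open>l\<close> can have
  neighbours outside its star.
\<close>

definition star_partition :: "'a pair_pre_digraph \<Rightarrow> 'a set \<Rightarrow> bool" where
  "star_partition G C \<longleftrightarrow> C \<subseteq> pverts G \<and>
     (\<forall>v \<in> pverts G. \<exists>c \<in> C. v \<in> closed_neighborhood G c) \<and>
     (\<forall>c \<in> C. \<forall>c' \<in> C. c \<noteq> c' \<longrightarrow> closed_neighborhood G c \<inter> closed_neighborhood G c' = {}) \<and>
     (\<forall>c \<in> C. 3 \<le> card (closed_neighborhood G c) \<and>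
       (\<exists>l \<in> closed_neighborhood G c - {c}. \<forall>y \<in> closed_neighborhood G c - {c, l}.
          closed_neighborhood G y = {c, y}))"

context tree_graph
begin

text \<open>
  The centres are the vertices with an attached leaf. The side condition \<open>N c \<noteq> {c, p}\<close> keeps the
  leaves of a star out of \<open>C\<close>. That the packed neighbourhoods are exactly the sets \<open>N c\<close> with
  \<open>c \<in> C\<close> follows because the leaf at \<open>c\<close> is covered by the packing and only \<open>N c\<close> can cover it.
\<close>

lemma star_partition_if_well_ve_dominated:
  assumes well: "well_ve_dominated G" and three: "3 \<le> card (pverts G)"
  obtains C where "star_partition G C"
proof -
  define C where "C = {c \<in> pverts G. \<exists>p. p \<noteq> c \<and> N p = {c, p} \<and> N c \<noteq> {c, p}}"
  obtain P where P: "P \<subseteq> parcs G" and disj: "disjoint_family_on NE P" and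
    exact: "\<And>D. minimal_ve_dominating_set G D \<Longrightarrow> D \<subseteq> (\<Union>e\<in>P. NE e) \<and> (\<forall>e\<in>P. card (D \<inter> NE e) = 1)"
    using well_ve_dominated_packing[OF well] by blast
  have one: "x = y" if "minimal_ve_dominating_set G D" "e \<in> P" "x \<in> D \<inter> NE e" "y \<in> D \<inter> NE e" for D e x y
  proof -
    have "card (D \<inter> NE e) = 1" using exact that by blast
    with that show ?thesis by (metis card_1_singletonE singletonD)
  qed
  have cover: "\<exists>e\<in>P. v \<in> NE e" if v: "v \<in> pverts G" for v
  proof -
    obtain y where "(v, y) \<in> parcs G" using ex_neighbour[OF v] three by auto
    then obtain D where "minimal_ve_dominating_set G D" "v \<in> D" by (rule ex_minimal_through)
    with exact show ?thesis by blast
  qed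
  have pendant: "\<exists>c\<in>C. NE (u, w) = N c" if uw: "(u, w) \<in> parcs G" and w: "N w \<subseteq> {u, w}" for u w
  proof -
    have Nw: "N w = {u, w}" "w \<noteq> u" "w \<in> N u" "u \<in> pverts G"
      using w uw arcs_symmetric no_loops' wellformed' by (auto simp: in_N_iff)
    have "N u \<noteq> {u, w}"
    proof
      assume "N u = {u, w}"
      with Nw have "pverts G \<subseteq> {u, w}" by (intro isolated_edge_is_all)
      then have "card (pverts G) \<le> card {u, w}" by (intro card_mono) auto
      with three Nw(2) show False by simp
    qed
    with Nw have "u \<in> C" unfolding C_def by blast
    moreover have "NE (u, w) = N u" using Nw by (auto simp: edge_nbhd_def in_N_iff)
    ultimately show ?thesis by blast
  qed
  have centred: "\<exists>c\<in>C. NE e = N c" if e: "e \<in> P" for e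
  proof -
    obtain u w where e': "e = (u, w)" by (cases e)
    have uw: "(u, w) \<in> parcs G" "(w, u) \<in> parcs G" using e e' P arcs_symmetric by blast+
    have "N w \<subseteq> {u, w} \<or> N u \<subseteq> {w, u}"
    proof (rule ccontr)
      assume "\<not> ?thesis"
      then obtain a b where "a \<in> N u - {u, w}" "b \<in> N w - {u, w}" by blast
      then have ab: "(a, u) \<in> parcs G" "a \<noteq> w" "(w, b) \<in> parcs G" "b \<noteq> u"
        using arcs_symmetric by (auto simp: in_N_iff)
      obtain D where D: "minimal_ve_dominating_set G D" "a \<in> D" "b \<in> D" "a \<noteq> b"
        using ex_minimal_through_both_sides[OF ab(1) uw(1) ab(3) ab(2) ab(4)] .
      moreover have "a \<in> NE e" "b \<in> NE e" using ab arcs_symmetric by (auto simp: e' in_NE_iff in_N_iff)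
      ultimately show False using one[OF D(1) e] by blast
    qed
    moreover have "NE (w, u) = NE e" by (auto simp: e' edge_nbhd_def)
    ultimately show ?thesis using pendant[OF uw(1)] pendant[OF uw(2)] e' by metis
  qed
  have leaf_centre: "c' = c" if "c' \<in> C" "p \<in> N c'" "p \<noteq> c" "N p = {c, p}" "N c \<noteq> {c, p}" for c c' p
  proof -
    have "c' \<in> {c, p}" using that(2,4) N_sym[of p c'] by simp
    moreover have "c' \<noteq> p"
    proof
      assume "c' = p"
      then obtain p' where p': "p' \<noteq> p" "N p' = {p, p'}" "N p \<noteq> {p, p'}"
        using \<open>c' \<in> C\<close> by (auto simp: C_def)
      then have "p' \<in> N p" using N_sym[of p p'] by simp
      then have "p' = c" using that(4) p'(1) by simp
      with p' that(4,5) show False by (simp add: insert_commute)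
    qed
    ultimately show ?thesis by blast
  qed
  have packed: "\<exists>e\<in>P. NE e = N c" if c: "c \<in> C" for c
  proof -
    obtain p where p: "p \<noteq> c" "N p = {c, p}" "N c \<noteq> {c, p}" using c by (auto simp: C_def)
    then have "p \<in> pverts G" using c N_subset[of c] N_sym[of p c] by (auto simp: C_def)
    then obtain e where e: "e \<in> P" "p \<in> NE e" using cover by blast
    with centred obtain c' where "c' \<in> C" "NE e = N c'" by blast
    with leaf_centre[of c' p c] p e show ?thesis by blast
  qed
  have unique: "c = c'" if c: "c \<in> C" "c' \<in> C" and v: "v \<in> N c" "v \<in> N c'" for c c' v
  proof -
    obtain e e' where e: "e \<in> P" "NE e = N c" "e' \<in> P" "NE e' = N c'" using packed c by metis
    have "e = e'"
    proof (rule ccontr)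
      assume "e \<noteq> e'"
      with disj e(1,3) have "NE e \<inter> NE e' = {}" by (simp add: disjoint_family_on_def)
      with e v show False by auto
    qed
    obtain p where p: "p \<noteq> c" "N p = {c, p}" "N c \<noteq> {c, p}" using c by (auto simp: C_def)
    moreover from p have "p \<in> N c" using N_sym[of p c] by simp
    ultimately have "p \<in> N c'" using e \<open>e = e'\<close> by simp
    from leaf_centre[OF c(2) this p] show ?thesis ..
  qed
  have covC: "\<exists>c\<in>C. v \<in> N c" if "v \<in> pverts G" for v
    using cover[OF that] centred by metis
  have leaf: "\<exists>p. p \<noteq> c \<and> N p = {c, p}" if "c \<in> C" for c
    using that by (auto simp: C_def)
  have size: "3 \<le> card (N c)" if c: "c \<in> C" for c
  proof -
    obtain p where p: "p \<noteq> c" "N p = {c, p}" "N c \<noteq> {c, p}" using c by (auto simp: C_def)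
    have "c \<in> N c" by (simp add: in_N_iff)
    moreover have "p \<in> N c" using p(2) N_sym[of p c] by simp
    ultimately have "{c, p} \<subset> N c" using p(3) by blast
    moreover have "c \<in> pverts G" using c by (simp add: C_def)
    then have "finite (N c)" using finite_subset[OF N_subset finite_verts] by blast
    ultimately have "card {c, p} < card (N c)" by (intro psubset_card_mono)
    with p show ?thesis by simp
  qed
  have link: "\<exists>l \<in> N c - {c}. \<forall>y \<in> N c - {c, l}. N y = {c, y}" if c: "c \<in> C" for c
  proof (rule ccontr)
    assume neg: "\<not> ?thesis"
    have branch: "\<exists>z. z \<noteq> c \<and> (y, z) \<in> parcs G" if "y \<in> N c" "N y \<noteq> {c, y}" for y
    proof -
      have "c \<in> N y" using that(1) N_sym[of y c] by simp
      moreover have "y \<in> N y" by (simp add: in_N_iff)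
      ultimately have "{c, y} \<subseteq> N y" by blast
      with that obtain z where "z \<in> N y" "z \<notin> {c, y}" by blast
      then show ?thesis by (auto simp: in_N_iff)
    qed
    obtain p where p: "p \<noteq> c" "N p = {c, p}" using leaf[OF c] by blast
    then have "p \<in> N c - {c}" using N_sym[of p c] by simp
    with neg obtain y where y: "y \<in> N c" "y \<noteq> c" "N y \<noteq> {c, y}" by blast
    with neg obtain y' where y': "y' \<in> N c" "y' \<noteq> c" "y' \<noteq> y" "N y' \<noteq> {c, y'}" by blast
    obtain z z' where z: "z \<noteq> c" "(y, z) \<in> parcs G" "z' \<noteq> c" "(y', z') \<in> parcs G"
      using branch y y' by metis
    have cy: "(c, y) \<in> parcs G" "(c, y') \<in> parcs G" using y y' by (auto simp: in_N_iff)
    obtain D where D: "minimal_ve_dominating_set G D" "y \<in> D" "y' \<in> D"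
      by (rule ex_minimal_through_two_branches[OF unique covC leaf c y'(3)[symmetric]
            z(1,3) cy(1) z(2) cy(2) z(4)])
    obtain e where "e \<in> P" "NE e = N c" using packed[OF c] by blast
    with one[OF D(1), of e y y'] D y y' show False by blast
  qed
  have "star_partition G C"
    unfolding star_partition_def
  proof (intro conjI ballI impI)
    show "C \<subseteq> pverts G" by (auto simp: C_def)
    show "N c \<inter> N c' = {}" if "c \<in> C" "c' \<in> C" "c \<noteq> c'" for c c'
      using unique that by blast
  qed (fact covC size link)+
  then show thesis by (rule that)
qed

text \<open>
  Within one star, a leaf dominates the fewest edges, the centre more, and \<open>l\<close> the most: apart from
  the edges of the star, the centre dominates exactly the edges at \<open>l\<close>. So of two members of the same
  star one is redundant.
\<close>

lemma well_ve_dominated_if_star_partition: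
  assumes C: "star_partition G C"
  shows "well_ve_dominated G"
proof -
  have CV: "C \<subseteq> pverts G" and cover: "\<And>v. v \<in> pverts G \<Longrightarrow> \<exists>c\<in>C. v \<in> N c"
    and disj: "\<And>c c'. c \<in> C \<Longrightarrow> c' \<in> C \<Longrightarrow> c \<noteq> c' \<Longrightarrow> N c \<inter> N c' = {}"
    using C by (simp_all add: star_partition_def)
  have "card D = card C" if D: "minimal_ve_dominating_set G D" for D
  proof -
    have DV: "D \<subseteq> pverts G" and hit: "\<And>e. e \<in> parcs G \<Longrightarrow> D \<inter> NE e \<noteq> {}"
      using D by (auto simp: minimal_ve_dominating_set_def ve_dominating_set_iff)
    have one: "card (D \<inter> N c) = 1" if c: "c \<in> C" for c
    proof -
      have three: "3 \<le> card (N c)" using C c by (auto simp: star_partition_def)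
      obtain l where l: "l \<in> N c - {c}" and pend: "\<And>y. y \<in> N c - {c, l} \<Longrightarrow> N y = {c, y}"
      proof -
        have "\<exists>l \<in> N c - {c}. \<forall>y \<in> N c - {c, l}. N y = {c, y}"
          using C c by (simp add: star_partition_def)
        with that show thesis by blast
      qed
      have star_edge: "N c \<subseteq> NE e" if e: "e \<in> parcs G" "x \<in> NE e" and x: "x \<in> N c - {c, l}" for e x
      proof -
        obtain a b where ab: "e = (a, b)" by (cases e)
        then have "b \<in> N a" "a \<in> N b" using e(1) N_sym[of b a] by (simp_all add: in_N_iff)
        moreover have "a \<noteq> b" using e(1) ab no_loops' by blast
        moreover have "x \<in> N a \<or> x \<in> N b" using e(2) by (simp add: ab in_NE_iff)
        then have "a \<in> N x \<or> b \<in> N x" using N_sym[of x a] N_sym[of x b] by simp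
        ultimately have "a = c \<or> b = c" using pend[OF x] by auto
        then show ?thesis by (auto simp: ab in_NE_iff)
      qed
      have c_edge: "l \<in> NE e" if e: "e \<in> parcs G" "c \<in> NE e" for e
      proof -
        have "l \<in> NE (a, b)" if "(a, b) \<in> parcs G" "a \<in> N c" for a b
        proof -
          have "b \<in> N a" "b \<noteq> a" using that no_loops' by (auto simp: in_N_iff)
          then have "a = c \<or> a = l \<or> b = c" using that pend[of a] by auto
          moreover have "l \<in> N c" "l \<in> N l" using l by (auto simp: in_N_iff)
          ultimately show ?thesis by (auto simp: in_NE_iff)
        qed
        note half = this
        obtain a b where ab: "e = (a, b)" by (cases e)
        then have "a \<in> N c \<or> b \<in> N c" using e(2) N_sym[of c a] N_sym[of c b] by (simp add: in_NE_iff)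
        moreover have "(b, a) \<in> parcs G" using e(1) ab arcs_symmetric by blast
        moreover have "NE (b, a) = NE (a, b)" by (auto simp: edge_nbhd_def)
        ultimately show ?thesis using half[of a b] half[of b a] e(1) ab by auto
      qed
      have "\<not> N c \<subseteq> {c, l}"
        using three card_mono[of "{c, l}" "N c"] card_insert_le_m1[of 2 "{l}" c] by auto
      then obtain p where p: "p \<in> N c - {c, l}" by blast
      then have "(c, p) \<in> parcs G" by (auto simp: in_N_iff)
      moreover have "NE (c, p) = N c" using pend[OF p] p by (auto simp: edge_nbhd_def) (simp add: in_N_iff)
      ultimately have "D \<inter> N c \<noteq> {}" using hit by metis
      then obtain x0 where x0: "x0 \<in> D \<inter> N c" by blast
      have eq: "x = y" if xy: "x \<in> D \<inter> N c" "y \<in> D \<inter> N c" for x y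
      proof (rule ccontr)
        assume "x \<noteq> y"
        have red: False if "x \<in> D \<inter> N c" "y \<in> D \<inter> N c" "x \<noteq> y" "x \<noteq> l" "x = c \<longrightarrow> y = l" for x y
        proof (rule minimal_no_redundant[OF D _ _ \<open>x \<noteq> y\<close>])
          fix e assume "e \<in> parcs G" "x \<in> NE e"
          with star_edge[of e x] c_edge[of e] that show "y \<in> NE e" by (cases "x = c") auto
        qed (use that in auto)
        show False
        proof (cases "x \<noteq> l \<and> (x = c \<longrightarrow> y = l)")
          case True
          with red[of x y] xy \<open>x \<noteq> y\<close> show False by blast
        next
          case False
          with red[of y x] xy \<open>x \<noteq> y\<close> l show False by blast
        qed
      qed
      have "D \<inter> N c = {x0}" using eq[OF _ x0] x0 by blast
      then show ?thesis by simp
    qed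
    have "D = (\<Union>c\<in>C. D \<inter> N c)" using DV cover by blast
    also have "card \<dots> = (\<Sum>c\<in>C. card (D \<inter> N c))"
    proof (rule card_UN_disjoint)
      show "finite C" using CV finite_verts by (rule finite_subset)
      have "finite D" using DV finite_verts by (rule finite_subset)
      then show "\<forall>c\<in>C. finite (D \<inter> N c)" by simp
      show "\<forall>c\<in>C. \<forall>c'\<in>C. c \<noteq> c' \<longrightarrow> D \<inter> N c \<inter> (D \<inter> N c') = {}" using disj by blast
    qed
    also have "\<dots> = card C" using one by simp
    finally show ?thesis .
  qed
  then show ?thesis by (simp add: well_ve_dominated_def)
qed

end

section \<open>Star partitions and the family of trees\<close>

definition star_graph :: "'a \<Rightarrow> 'a set \<Rightarrow> 'a pair_pre_digraph" where
  "star_graph c X = \<lparr> pverts = insert c X, parcs = {c} \<times> X \<union> X \<times> {c} \<rparr>"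

lemma star_graph_simps [simp]:
  "pverts (star_graph c X) = insert c X"
  "(u, v) \<in> parcs (star_graph c X) \<longleftrightarrow> u = c \<and> v \<in> X \<or> u \<in> X \<and> v = c"
  by (auto simp: star_graph_def)

text \<open>
  From order three on, the centre is determined: it is the singleton class of the bipartition, and
  the leaves of the star are the other vertices.
\<close>

lemma is_star_iff:
  "is_star S \<and> 3 \<le> card (pverts S) \<longleftrightarrow> (\<exists>c X. 2 \<le> card X \<and> c \<notin> X \<and> S = star_graph c X)"
  (is "?L \<longleftrightarrow> ?R")
proof
  assume L: ?L
  then obtain U X where UX: "pverts S = U \<union> X" "U \<inter> X = {}" "card U = 1" "parcs S = U \<times> X \<union> X \<times> U"
    unfolding is_star_def complete_bipartite_digraph_pair_def by blast
  then obtain c where c: "U = {c}" by (meson card_1_singletonE)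
  have "finite (pverts S)" using L by (intro card_ge_0_finite) auto
  then have "card (pverts S) = Suc (card X)" using UX c by simp
  then have "2 \<le> card X" "c \<notin> X" "S = star_graph c X"
    using L UX c by (auto simp: star_graph_def intro!: pair_pre_digraph.equality)
  then show ?R by blast
next
  assume ?R
  then obtain c X where cX: "2 \<le> card X" "c \<notin> X" "S = star_graph c X" by blast
  then have fin: "finite X" by (intro card_ge_0_finite) auto
  have "complete_bipartite_digraph 1 (card X) (with_proj S)"
    unfolding complete_bipartite_digraph_pair_def
    using cX fin by (intro conjI exI[of _ "{c}"] exI[of _ X]) (auto simp: star_graph_def)
  then show ?L using cX fin by (auto simp: is_star_def)
qed

lemma leaves_star_graph:
  assumes "2 \<le> card X" "c \<notin> X"
  shows "leaves (star_graph c X) = X"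
proof -
  have "out_arcs (with_proj (star_graph c X)) c = {c} \<times> X"
    using assms by (auto simp: out_arcs_def)
  then have "out_degree (with_proj (star_graph c X)) c \<noteq> 1"
    using assms by (simp add: out_degree_def card_cartesian_product)
  moreover have "out_degree (with_proj (star_graph c X)) v = 1" if "v \<in> X" for v
  proof -
    have "out_arcs (with_proj (star_graph c X)) v = {(v, c)}"
      using assms that by (auto simp: out_arcs_def)
    then show ?thesis by (simp add: out_degree_def)
  qed
  ultimately show ?thesis by (auto simp: leaves_def)
qed

text \<open>
  The added edges join leaves, so the closed neighbourhood of a centre is still its star. A leaf
  other than the selected one keeps degree one, because an added edge at it would also contain
  the selected leaf of the same star, although added edges join distinct stars.
\<close>

lemma star_partition_if_T_wc:
  assumes "G \<in> T_wc"
  obtains C where "star_partition G C"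
proof -
  obtain r and S :: "nat \<Rightarrow> 'a pair_pre_digraph" and F where
    stars: "\<forall>i<r. is_star (S i) \<and> 3 \<le> card (pverts (S i))" and
    disj: "\<forall>i<r. \<forall>j<r. i \<noteq> j \<longrightarrow> pverts (S i) \<inter> pverts (S j) = {}" and
    F: "\<forall>e \<in> F. \<exists>i<r. \<exists>j<r. i \<noteq> j \<and> (\<exists>u \<in> leaves (S i). \<exists>v \<in> leaves (S j). e = {u, v})" and
    link: "\<forall>i<r. \<exists>l \<in> leaves (S i). \<forall>e \<in> F. e \<inter> pverts (S i) \<noteq> {} \<longrightarrow> l \<in> e" and
    G: "G = \<lparr> pverts = (\<Union>i<r. pverts (S i)), parcs = (\<Union>i<r. parcs (S i)) \<union> {(u, v). {u, v} \<in> F} \<rparr>"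
    using assms unfolding T_wc_def by blast
  have "\<forall>i<r. \<exists>c X. 2 \<le> card X \<and> c \<notin> X \<and> S i = star_graph c X"
    using stars is_star_iff by blast
  then obtain c X where cX: "\<And>i. i < r \<Longrightarrow> 2 \<le> card (X i)" "\<And>i. i < r \<Longrightarrow> c i \<notin> X i"
      "\<And>i. i < r \<Longrightarrow> S i = star_graph (c i) (X i)"
    by metis
  have leaves: "leaves (S i) = X i" if "i < r" for i
    using leaves_star_graph cX that by metis
  have pv: "pverts (S i) = insert (c i) (X i)" if "i < r" for i using cX(3)[OF that] by simp
  have same: "i = j" if "v \<in> pverts (S i)" "v \<in> pverts (S j)" "i < r" "j < r" for i j v
    using disj that by blast
  have Fleaf: "\<exists>i j. i < r \<and> j < r \<and> i \<noteq> j \<and> u \<in> X i \<and> v \<in> X j" if "{u, v} \<in> F" for u v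
  proof -
    from bspec[OF F that] obtain i j a b where
      ij: "i < r" "j < r" "i \<noteq> j" "a \<in> leaves (S i)" "b \<in> leaves (S j)" "{u, v} = {a, b}"
      by (elim exE conjE bexE)
    from ij(6) consider "u = a" "v = b" | "u = b" "v = a" by (auto simp: doubleton_eq_iff)
    then show ?thesis
    proof cases
      case 1
      with ij leaves show ?thesis by (intro exI[of _ i] exI[of _ j]) simp
    next
      case 2
      with ij leaves show ?thesis by (intro exI[of _ j] exI[of _ i]) simp
    qed
  qed
  have arcs: "(u, v) \<in> parcs G \<longleftrightarrow>
      (\<exists>i<r. u = c i \<and> v \<in> X i \<or> u \<in> X i \<and> v = c i) \<or> {u, v} \<in> F" for u v
    using cX(3) by (auto simp: G)
  have Nc: "closed_neighborhood G (c i) = insert (c i) (X i)" if i: "i < r" for i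
  proof -
    have "v \<in> X i" if v: "(c i, v) \<in> parcs G" for v
    proof -
      have "{c i, v} \<notin> F"
      proof
        assume "{c i, v} \<in> F"
        then obtain j where "j < r" "c i \<in> X j" using Fleaf by blast
        with same[of "c i" i j] pv i cX(2) show False by auto
      qed
      then obtain j where j: "j < r" "c i = c j \<and> v \<in> X j \<or> c i \<in> X j \<and> v = c j"
        using v arcs by blast
      with same[of "c i" i j] pv i cX(2) show ?thesis by auto
    qed
    moreover have "(c i, v) \<in> parcs G" if "v \<in> X i" for v using arcs that i by blast
    ultimately show ?thesis unfolding closed_neighborhood_def by blast
  qed
  have Nleaf: "\<exists>l \<in> X i. \<forall>y \<in> X i - {l}. closed_neighborhood G y = {c i, y}" if i: "i < r" for i
  proof -
    have "\<exists>l \<in> X i. \<forall>e \<in> F. e \<inter> pverts (S i) \<noteq> {} \<longrightarrow> l \<in> e"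
      using link[rule_format, OF i] unfolding leaves[OF i] .
    then obtain l where l: "l \<in> X i" "\<forall>e \<in> F. e \<inter> pverts (S i) \<noteq> {} \<longrightarrow> l \<in> e"
      by (elim bexE)
    have "v = c i" if y: "y \<in> X i" "y \<noteq> l" and v: "(y, v) \<in> parcs G" for y v
    proof -
      have "{y, v} \<notin> F"
      proof
        assume yv: "{y, v} \<in> F"
        have "{y, v} \<inter> pverts (S i) \<noteq> {}" using y(1) pv[OF i] by simp
        with bspec[OF l(2) yv] have "l \<in> {y, v}" by (rule mp)
        then have "v = l" using y(2) by simp
        obtain j k where jk: "j < r" "k < r" "j \<noteq> k" "y \<in> X j" "v \<in> X k" using Fleaf[OF yv] by blast
        have "y \<in> pverts (S i)" "y \<in> pverts (S j)" "v \<in> pverts (S i)" "v \<in> pverts (S k)"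
          using jk y(1) l(1) \<open>v = l\<close> pv[OF i] pv[OF jk(1)] pv[OF jk(2)] by simp_all
        then have "i = j" "i = k" using same i jk(1,2) by blast+
        with jk show False by simp
      qed
      then obtain j where j: "j < r" "y = c j \<and> v \<in> X j \<or> y \<in> X j \<and> v = c j"
        using v arcs by blast
      then have "y \<in> pverts (S i)" "y \<in> pverts (S j)" using y(1) pv[OF i] pv[OF j(1)] by auto
      then have "i = j" using same i j(1) by blast
      with j(2) y(1) cX(2)[OF i] show ?thesis by blast
    qed
    moreover have "(y, c i) \<in> parcs G" if "y \<in> X i" for y using arcs that i by blast
    ultimately have "\<forall>y \<in> X i - {l}. closed_neighborhood G y = {c i, y}"
      unfolding closed_neighborhood_def by blast
    with l show ?thesis by blast
  qed
  have "star_partition G (c ` {..<r})"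
    unfolding star_partition_def
  proof (intro conjI ballI impI)
    show "c ` {..<r} \<subseteq> pverts G" using pv by (auto simp: G)
    show "\<exists>c' \<in> c ` {..<r}. v \<in> closed_neighborhood G c'" if "v \<in> pverts G" for v
      using that pv Nc by (auto simp: G)
    fix d assume "d \<in> c ` {..<r}"
    then obtain i where i: "i < r" "d = c i" by blast
    have "finite (X i)" using cX(1)[OF i(1)] by (intro card_ge_0_finite) auto
    then show "3 \<le> card (closed_neighborhood G d)" using Nc cX i by simp
    show "\<exists>l \<in> closed_neighborhood G d - {d}. \<forall>y \<in> closed_neighborhood G d - {d, l}.
        closed_neighborhood G y = {d, y}"
      using Nleaf[OF i(1)] Nc[OF i(1)] cX(2)[OF i(1)] unfolding i(2) by auto
    fix d' assume "d' \<in> c ` {..<r}" "d \<noteq> d'"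
    then obtain j where j: "j < r" "d' = c j" "i \<noteq> j" using i by blast
    have "pverts (S i) \<inter> pverts (S j) = {}" using disj i(1) j by blast
    then show "closed_neighborhood G d \<inter> closed_neighborhood G d' = {}"
      using Nc[OF i(1)] Nc[OF j(1)] pv[OF i(1)] pv[OF j(1)] i(2) j(2) by simp
  qed
  then show thesis by (rule that)
qed

context tree_graph
begin

text \<open>
  A tree has one edge less than it has vertices, as each vertex except the root is joined to its
  parent. The star edges correspond to the vertices that are not centres. The number
  of the remaining edges is therefore one less than the number of centres.
\<close>

lemma card_edges_off_centres:
  assumes C: "star_partition G C"
  shows "card {{u, v} | u v. (u, v) \<in> parcs G \<and> u \<notin> C \<and> v \<notin> C} = card C - 1"
    and "finite {{u, v} | u v. (u, v) \<in> parcs G \<and> u \<notin> C \<and> v \<notin> C}"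
    and "1 \<le> card C"
proof -
  let ?V = "pverts G"
  let ?F = "{{u, v} | u v. (u, v) \<in> parcs G \<and> u \<notin> C \<and> v \<notin> C}"
  have CV: "C \<subseteq> ?V" and cover: "\<And>v. v \<in> ?V \<Longrightarrow> \<exists>c\<in>C. v \<in> N c"
    and disj: "\<And>c c'. c \<in> C \<Longrightarrow> c' \<in> C \<Longrightarrow> c \<noteq> c' \<Longrightarrow> N c \<inter> N c' = {}"
    using C by (simp_all add: star_partition_def)
  obtain r where r: "r \<in> ?V" using verts_nonempty by blast
  obtain par lev where root: "rooting r par lev" using tree_rooting[OF r] .
  obtain ctr where ctr: "\<And>v. v \<in> ?V \<Longrightarrow> ctr v \<in> C \<and> v \<in> N (ctr v)" using cover by metis
  have finC: "finite C" using CV finite_verts by (rule finite_subset)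
  have "C \<noteq> {}" using ctr r by blast
  then show pos: "1 \<le> card C" using finC by (simp add: Suc_le_eq card_gt_0_iff)
  define E where "E = (\<lambda>v. {v, par v}) ` (?V - {r})"
  define B where "B = (\<lambda>v. {v, ctr v}) ` (?V - C)"
  have E: "{u, v} \<in> E \<longleftrightarrow> (u, v) \<in> parcs G" if "u \<noteq> v" for u v
  proof
    assume "{u, v} \<in> E"
    then obtain x where "x \<in> ?V" "x \<noteq> r" "{u, v} = {x, par x}" by (auto simp: E_def)
    then show "(u, v) \<in> parcs G"
      using rooting_parD(1,2)[OF root, of x] by (auto simp: doubleton_eq_iff)
  next
    assume uv: "(u, v) \<in> parcs G"
    then have "u \<in> ?V" "v \<in> ?V" using wellformed' by blast+
    then show "{u, v} \<in> E" using rooting_arcD[OF root uv] by (auto simp: E_def insert_commute)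
  qed
  have "inj_on (\<lambda>v. {v, par v}) (?V - {r})"
  proof (rule inj_onI)
    fix x y assume xy: "x \<in> ?V - {r}" "y \<in> ?V - {r}" "{x, par x} = {y, par y}"
    with rooting_parD(4)[OF root, of x] rooting_parD(4)[OF root, of y]
    show "x = y" by (auto simp: doubleton_eq_iff)
  qed
  then have cardE: "card E = card ?V - 1" using r by (simp add: E_def card_image)
  have "inj_on (\<lambda>v. {v, ctr v}) (?V - C)"
    using ctr by (auto simp: inj_on_def doubleton_eq_iff)
  then have cardB: "card B = card ?V - card C"
    using CV finC by (simp add: B_def card_image card_Diff_subset)
  have ctr_arc: "(ctr v, v) \<in> parcs G" if "v \<in> ?V - C" for v
    using ctr[of v] that by (auto simp: in_N_iff)
  have BE: "B \<subseteq> E"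
  proof
    fix e assume "e \<in> B"
    then obtain v where v: "v \<in> ?V - C" "e = {ctr v, v}" by (auto simp: B_def)
    then show "e \<in> E" using E ctr_arc[OF v(1)] no_loops' by auto
  qed
  have "?F = E - B"
  proof (intro subset_antisym subsetI)
    fix e assume "e \<in> ?F"
    then obtain u v where e: "e = {u, v}" "(u, v) \<in> parcs G" "u \<notin> C" "v \<notin> C" by blast
    then have "e \<in> E" using E no_loops' by blast
    moreover have "e \<notin> B"
    proof
      assume "e \<in> B"
      then obtain x where "x \<in> ?V" "ctr x \<in> e" by (auto simp: B_def)
      with ctr e show False by auto
    qed
    ultimately show "e \<in> E - B" by blast
  next
    fix e assume e: "e \<in> E - B"
    then obtain x where x: "e = {x, par x}" "x \<in> ?V" "x \<noteq> r" by (auto simp: E_def)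
    note arcs = rooting_parD(1,2,3)[OF root x(2,3)]
    have star: "{c, y} \<in> B" if "c \<in> C" "(c, y) \<in> parcs G" for c y
    proof -
      have y: "y \<in> ?V" "y \<in> N c" "y \<in> N y" using that wellformed' by (auto simp: in_N_iff)
      have "ctr y = c" using ctr[OF y(1)] disj that(1) y(2) by blast
      moreover have "y \<notin> C"
      proof
        assume "y \<in> C"
        then have "y = c" using disj that(1) y by blast
        with that no_loops' show False by blast
      qed
      ultimately show ?thesis using y(1) by (auto simp: B_def insert_commute)
    qed
    have "x \<notin> C" using star[of x "par x"] arcs e x by auto
    moreover have "par x \<notin> C" using star[of "par x" x] arcs e x by (auto simp: insert_commute)
    ultimately show "e \<in> ?F" using x arcs by blast
  qed
  moreover have "finite E" using finite_verts by (simp add: E_def)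
  ultimately show "finite ?F" and "card ?F = card C - 1"
    using cardE cardB BE pos card_mono[OF finite_verts CV] by (auto simp: card_Diff_subset finite_subset)
qed

text \<open>
  The added edges are those that avoid \<open>C\<close>: a centre has no neighbours outside its own star. Two
  leaves of one star are not adjacent, since a tree has no triangles.
\<close>

lemma T_wc_if_star_partition:
  assumes C: "star_partition G C"
  shows "G \<in> T_wc"
proof -
  let ?V = "pverts G"
  have CV: "C \<subseteq> ?V" and cover: "\<And>v. v \<in> ?V \<Longrightarrow> \<exists>c\<in>C. v \<in> N c"
    and disj: "\<And>c c'. c \<in> C \<Longrightarrow> c' \<in> C \<Longrightarrow> c \<noteq> c' \<Longrightarrow> N c \<inter> N c' = {}"
    and three: "\<And>c. c \<in> C \<Longrightarrow> 3 \<le> card (N c)"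
    and link: "\<And>c. c \<in> C \<Longrightarrow> \<exists>l \<in> N c - {c}. \<forall>y \<in> N c - {c, l}. N y = {c, y}"
    using C by (simp_all add: star_partition_def)
  define r where "r = card C"
  define F where "F = {{u, v} | u v. (u, v) \<in> parcs G \<and> u \<notin> C \<and> v \<notin> C}"
  have F: "card F = r - 1" "finite F" "1 \<le> r"
    unfolding r_def F_def by (rule card_edges_off_centres[OF C])+
  have finC: "finite C" using CV finite_verts by (rule finite_subset)
  obtain h where "bij_betw h {0..<r} C" using ex_bij_betw_nat_finite[OF finC] unfolding r_def by blast
  then have h: "h ` {..<r} = C" "inj_on h {..<r}" by (simp_all add: bij_betw_def lessThan_atLeast0)
  have hC: "h i \<in> C" if "i < r" for i using h(1) that by blast
  define X where "X i = N (h i) - {h i}" for i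
  define S where "S i = star_graph (h i) (X i)" for i
  have NX: "N (h i) = insert (h i) (X i)" for i by (auto simp: X_def in_N_iff)
  have pS: "pverts (S i) = N (h i)" for i by (simp add: S_def NX)
  have big: "2 \<le> card (X i)" if "i < r" for i
  proof -
    have "h i \<in> N (h i)" by (simp add: NX)
    then show ?thesis using three[OF hC[OF that]] by (simp add: X_def card_Diff_singleton)
  qed
  have leaves: "leaves (S i) = X i" if "i < r" for i
    unfolding S_def using big[OF that] by (intro leaves_star_graph) (auto simp: X_def)
  have index: "\<exists>i<r. v \<in> N (h i)" if "v \<in> ?V" for v
    using cover[OF that] h(1) by blast
  have triangle_free: "(u, v) \<notin> parcs G" if "c \<in> C" "u \<in> N c - {c}" "v \<in> N c - {c}" for c u v
  proof
    assume uv: "(u, v) \<in> parcs G"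
    have "c \<in> ?V" using that CV by blast
    then obtain par lev where root: "rooting c par lev" using tree_rooting by blast
    have "(c, u) \<in> parcs G" "(c, v) \<in> parcs G" using that by (auto simp: in_N_iff)
    from rooting_childD[OF root this(1)] rooting_childD[OF root this(2)] rooting_arcD[OF root uv]
    show False by auto
  qed
  have "\<forall>i<r. is_star (S i) \<and> 3 \<le> card (pverts (S i))"
    unfolding is_star_iff using big by (auto simp: S_def X_def)
  moreover have "\<forall>i<r. \<forall>j<r. i \<noteq> j \<longrightarrow> pverts (S i) \<inter> pverts (S j) = {}"
  proof (intro allI impI)
    fix i j assume "i < r" "j < r" "i \<noteq> j"
    moreover from this have "h i \<noteq> h j" using h(2) by (auto dest: inj_onD)
    ultimately show "pverts (S i) \<inter> pverts (S j) = {}" unfolding pS using disj hC by blast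
  qed
  moreover have "\<forall>e \<in> F. \<exists>i<r. \<exists>j<r. i \<noteq> j \<and> (\<exists>u \<in> leaves (S i). \<exists>v \<in> leaves (S j). e = {u, v})"
  proof
    fix e assume "e \<in> F"
    then obtain u v where e: "e = {u, v}" "(u, v) \<in> parcs G" "u \<notin> C" "v \<notin> C"
      unfolding F_def by blast
    then have "u \<in> ?V" "v \<in> ?V" using wellformed' by blast+
    then obtain i j where ij: "i < r" "u \<in> N (h i)" "j < r" "v \<in> N (h j)" using index by metis
    then have X: "u \<in> X i" "v \<in> X j" using e hC unfolding X_def by blast+
    then have "i \<noteq> j" using triangle_free[OF hC[OF ij(1)], of u v] e(2) unfolding X_def by blast
    with X ij e(1) leaves show "\<exists>i<r. \<exists>j<r. i \<noteq> j \<and> (\<exists>u \<in> leaves (S i). \<exists>v \<in> leaves (S j). e = {u, v})"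
      by metis
  qed
  moreover have "\<forall>i<r. \<exists>l \<in> leaves (S i). \<forall>e \<in> F. e \<inter> pverts (S i) \<noteq> {} \<longrightarrow> l \<in> e"
  proof (intro allI impI)
    fix i assume i: "i < r"
    obtain l where l: "l \<in> X i" "\<And>y. y \<in> N (h i) - {h i, l} \<Longrightarrow> N y = {h i, y}"
      using link[OF hC[OF i]] unfolding X_def by blast
    have tip: "u = l" if "u \<in> N (h i)" "(u, v) \<in> parcs G" "u \<notin> C" "v \<notin> C" for u v
    proof (rule ccontr)
      assume "u \<noteq> l"
      moreover have "u \<noteq> h i" using that(3) hC[OF i] by blast
      ultimately have "N u = {h i, u}" using l(2) that(1) by blast
      moreover have "v \<in> N u" "v \<noteq> u" using that(2) no_loops' by (auto simp: in_N_iff)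
      ultimately show False using that(4) hC[OF i] by auto
    qed
    have "l \<in> e" if e: "e \<in> F" "e \<inter> N (h i) \<noteq> {}" for e
    proof -
      obtain u v where uv: "e = {u, v}" "(u, v) \<in> parcs G" "u \<notin> C" "v \<notin> C"
        using e(1) unfolding F_def by blast
      have vu: "(v, u) \<in> parcs G" using uv(2) arcs_symmetric by blast
      from e(2) uv(1) have "u \<in> N (h i) \<or> v \<in> N (h i)" by blast
      then show ?thesis using tip[OF _ uv(2,3,4)] tip[OF _ vu uv(4,3)] uv(1) by blast
    qed
    then show "\<exists>l \<in> leaves (S i). \<forall>e \<in> F. e \<inter> pverts (S i) \<noteq> {} \<longrightarrow> l \<in> e"
      unfolding pS leaves[OF i] using l(1) by blast
  qed
  moreover have "G = \<lparr> pverts = (\<Union>i<r. pverts (S i)), parcs = (\<Union>i<r. parcs (S i)) \<union> {(u, v). {u, v} \<in> F} \<rparr>"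
  proof -
    have "?V = (\<Union>i<r. pverts (S i))"
    proof (intro subset_antisym subsetI)
      show "v \<in> (\<Union>i<r. pverts (S i))" if "v \<in> ?V" for v using index[OF that] by (auto simp: pS)
      show "v \<in> ?V" if v: "v \<in> (\<Union>i<r. pverts (S i))" for v
      proof -
        obtain i where i: "i < r" "v \<in> N (h i)" using v by (auto simp: pS)
        then have "h i \<in> ?V" using hC CV by blast
        with i(2) N_subset show ?thesis by blast
      qed
    qed
    moreover have "(u, v) \<in> parcs G \<longleftrightarrow> (\<exists>i<r. (u, v) \<in> parcs (S i)) \<or> {u, v} \<in> F" for u v
    proof
      assume uv: "(u, v) \<in> parcs G"
      then have ne: "u \<noteq> v" and vu: "(v, u) \<in> parcs G" using no_loops' arcs_symmetric by blast+
      show "(\<exists>i<r. (u, v) \<in> parcs (S i)) \<or> {u, v} \<in> F"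
      proof (cases "u \<in> C \<or> v \<in> C")
        case True
        then obtain i where i: "i < r" "u = h i \<or> v = h i" using h(1) by blast
        with uv vu ne have "(u, v) \<in> parcs (S i)" by (auto simp: S_def X_def in_N_iff)
        with i show ?thesis by blast
      next
        case False
        with uv show ?thesis unfolding F_def by blast
      qed
    next
      assume "(\<exists>i<r. (u, v) \<in> parcs (S i)) \<or> {u, v} \<in> F"
      then show "(u, v) \<in> parcs G"
      proof
        assume "\<exists>i<r. (u, v) \<in> parcs (S i)"
        then obtain i where "(u, v) \<in> parcs (S i)" by blast
        then have "(u, v) \<in> parcs G \<or> (v, u) \<in> parcs G" by (auto simp: S_def X_def in_N_iff)
        then show ?thesis using arcs_symmetric by blast
      next
        assume "{u, v} \<in> F"
        then obtain a b where "{u, v} = {a, b}" "(a, b) \<in> parcs G" unfolding F_def by blast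
        then show ?thesis using arcs_symmetric by (auto simp: doubleton_eq_iff)
      qed
    qed
    ultimately show ?thesis by (intro pair_pre_digraph.equality) auto
  qed
  ultimately show ?thesis
    unfolding T_wc_def using F tree by blast
qed

end

section \<open>Isomorphic copies\<close>

text \<open>
  For graphs whose arcs are pairs, an isomorphism amounts to an injective renaming of the vertices.
\<close>

definition relabel :: "('a \<Rightarrow> 'b) \<Rightarrow> 'a pair_pre_digraph \<Rightarrow> 'b pair_pre_digraph" where
  "relabel f G = \<lparr> pverts = f ` pverts G, parcs = map_prod f f ` parcs G \<rparr>"

lemma relabel_simps [simp]:
  "pverts (relabel f G) = f ` pverts G" "parcs (relabel f G) = map_prod f f ` parcs G"
  by (simp_all add: relabel_def)

definition relabel_iso :: "('a \<Rightarrow> 'b) \<Rightarrow> ('a, 'a \<times> 'a, 'b, 'b \<times> 'b) digraph_isomorphism" where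
  "relabel_iso f = \<lparr> iso_verts = f, iso_arcs = map_prod f f, iso_head = snd, iso_tail = fst \<rparr>"

lemma app_relabel_iso: "app_iso (relabel_iso f) (with_proj G) = with_proj (relabel f G)"
  by (simp add: app_iso_def relabel_iso_def with_proj_def)

lemma digraph_iso_imp_relabel:
  assumes "pair_wf_digraph G" "digraph_iso (with_proj G) (with_proj H)"
  obtains f where "inj_on f (pverts G)" "H = relabel f G"
proof -
  interpret pair_wf_digraph G by fact
  obtain hom where hom: "digraph_isomorphism hom" "with_proj H = app_iso hom (with_proj G)"
    using assms(2) by (auto simp: digraph_iso_def)
  define f where "f = iso_verts hom"
  from arg_cong[OF hom(2), of verts] have V: "pverts H = f ` pverts G" by (simp add: f_def)
  from arg_cong[OF hom(2), of arcs] have A: "parcs H = iso_arcs hom ` parcs G" by simp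
  from arg_cong[OF hom(2), of tail] arg_cong[OF hom(2), of head]
  have "iso_tail hom = fst" "iso_head hom = snd" by simp_all
  then have "iso_arcs hom a = map_prod f f a" if "a \<in> parcs G" for a
    using hom(1) that unfolding digraph_isomorphism_def f_def
    by (intro prod_eqI) auto
  then have "H = relabel f G" using V A by (intro pair_pre_digraph.equality) auto
  moreover have "inj_on f (pverts G)" using hom(1) by (simp add: digraph_isomorphism_def f_def)
  ultimately show thesis by (rule that[rotated])
qed

lemma (in wf_digraph) cycle_app_iso:
  assumes hom: "digraph_isomorphism hom" and p: "cycle p"
  shows "pre_digraph.cycle (app_iso hom G) (map (iso_arcs hom) p)"
proof -
  obtain u where u: "awalk u p u" "distinct (tl (awalk_verts u p))" "p \<noteq> []"
    using p by (auto simp: cycle_def)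
  have "set (awalk_verts u p) \<subseteq> verts G" using u(1) by (rule awalkE')
  moreover have "set (tl (awalk_verts u p)) \<subseteq> set (awalk_verts u p)"
    by (cases "awalk_verts u p") auto
  ultimately have "set (tl (awalk_verts u p)) \<subseteq> verts G" by (rule subset_trans[rotated])
  then have "distinct (map (iso_verts hom) (tl (awalk_verts u p)))"
    using u(2) digraph_isomorphism_inj_on_verts[OF hom] by (simp add: distinct_map inj_on_subset)
  then have "distinct (tl (pre_digraph.awalk_verts (app_iso hom G) (iso_verts hom u)
      (map (iso_arcs hom) p)))"
    by (simp only: awalk_verts_app_iso_eq[OF hom u(1)] map_tl)
  moreover have "pre_digraph.awalk (app_iso hom G) (iso_verts hom u) (map (iso_arcs hom) p)
      (iso_verts hom u)"
    by (rule awalk_app_isoI[OF u(1) hom])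
  ultimately show ?thesis using u(3) unfolding pre_digraph.cycle_def by blast
qed

context pair_graph
begin

context
  fixes f :: "'a \<Rightarrow> 'b"
  assumes inj: "inj_on f (pverts G)"
begin

lemma relabel_isomorphism: "digraph_isomorphism (relabel_iso f)"
proof -
  have "inj_on (map_prod f f) (pverts G \<times> pverts G)" using inj inj by (rule map_prod_inj_on)
  moreover have "parcs G \<subseteq> pverts G \<times> pverts G" using wellformed' by auto
  ultimately have "inj_on (map_prod f f) (parcs G)" by (rule inj_on_subset)
  then show ?thesis
    using inj wf_digraph_axioms by (auto simp: digraph_isomorphism_def relabel_iso_def)
qed

lemma digraph_iso_relabel: "digraph_iso (with_proj G) (with_proj (relabel f G))"
  unfolding digraph_iso_def using relabel_isomorphism app_relabel_iso by metis

lemma relabel_arc_iff: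
  assumes "u \<in> pverts G" "v \<in> pverts G"
  shows "(f u, f v) \<in> parcs (relabel f G) \<longleftrightarrow> (u, v) \<in> parcs G"
proof
  assume "(f u, f v) \<in> parcs (relabel f G)"
  then obtain a b where "(a, b) \<in> parcs G" "f u = f a" "f v = f b" by auto
  with inj assms wellformed' show "(u, v) \<in> parcs G" by (metis inj_onD)
qed (force simp: image_iff)

lemma pair_graph_relabel: "pair_graph (relabel f G)"
proof
  show "fst e \<in> pverts (relabel f G)" "snd e \<in> pverts (relabel f G)" if "e \<in> parcs (relabel f G)" for e
    using that wellformed' by auto
  show "finite (pverts (relabel f G))" "finite (parcs (relabel f G))"
    using finite_verts finite_arcs by simp_all
  show "fst e \<noteq> snd e" if e: "e \<in> parcs (relabel f G)" for e
  proof -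
    obtain u v where uv: "(u, v) \<in> parcs G" "e = (f u, f v)" using e by auto
    then have "u \<noteq> v" "u \<in> pverts G" "v \<in> pverts G" using no_loops' wellformed' by blast+
    with inj uv(2) show ?thesis by (auto dest: inj_onD)
  qed
  show "symmetric (with_proj (relabel f G))"
    using arcs_symmetric by (force simp: symmetric_def sym_def)
qed

text \<open>
  A cycle of the copy is carried back by the inverse isomorphism, which preserves the length.
\<close>

lemma undirected_tree_relabel:
  assumes tree: "undirected_tree G"
  shows "undirected_tree (relabel f G)"
proof -
  let ?H = "with_proj (relabel f G)" and ?hom = "relabel_iso f"
  have "Digraph_Component.connected ?H"
    using connectedI_app_iso[OF _ relabel_isomorphism] tree
    by (simp add: app_relabel_iso undirected_tree_def)
  moreover have "\<not> 3 \<le> length p" if p: "pre_digraph.cycle ?H p" for p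
  proof -
    let ?inv = "inv_iso ?hom"
    have "pre_digraph.digraph_isomorphism ?H ?inv"
      using digraph_isomorphism_invI[OF relabel_isomorphism] by (simp add: app_relabel_iso)
    moreover have "wf_digraph ?H"
      using wf_digraphI_app_iso[OF relabel_isomorphism] by (simp add: app_relabel_iso)
    moreover have "app_iso ?inv ?H = with_proj G"
      using app_iso_inv[OF relabel_isomorphism] by (simp add: app_relabel_iso)
    ultimately have "cycle (map (iso_arcs ?inv) p)"
      using wf_digraph.cycle_app_iso[of ?H ?inv p] p by simp
    with tree show ?thesis unfolding undirected_tree_def by (metis length_map)
  qed
  ultimately show ?thesis unfolding undirected_tree_def using pair_graph_relabel by blast
qed

lemma ve_dominating_set_relabel:
  assumes D: "D \<subseteq> pverts G"
  shows "ve_dominating_set (relabel f G) (f ` D) \<longleftrightarrow> ve_dominating_set G D"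
proof -
  have N: "f v \<in> closed_neighborhood (relabel f G) (f u) \<longleftrightarrow> v \<in> N u"
    if "u \<in> pverts G" "v \<in> pverts G" for u v
    using relabel_arc_iff[OF that] inj that
    by (auto simp: closed_neighborhood_def simp del: relabel_simps dest: inj_onD)
  have "f ` D \<inter> edge_nbhd (relabel f G) (map_prod f f e) \<noteq> {} \<longleftrightarrow> D \<inter> NE e \<noteq> {}"
    if e: "e \<in> parcs G" for e
  proof -
    obtain u w where uw: "e = (u, w)" by (cases e)
    have "u \<in> pverts G" "w \<in> pverts G" using e uw wellformed' by blast+
    then have "f v \<in> edge_nbhd (relabel f G) (map_prod f f e) \<longleftrightarrow> v \<in> NE e" if "v \<in> D" for v
      using N that D by (auto simp: edge_nbhd_def uw)
    then show ?thesis by blast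
  qed
  then have "(\<forall>e \<in> parcs (relabel f G). f ` D \<inter> edge_nbhd (relabel f G) e \<noteq> {}) \<longleftrightarrow>
      (\<forall>e \<in> parcs G. D \<inter> NE e \<noteq> {})"
    by simp
  then show ?thesis
    unfolding ve_dominating_set_iff pair_graph.ve_dominating_set_iff[OF pair_graph_relabel]
    using D by auto
qed

lemma minimal_ve_dominating_set_relabel:
  assumes D: "D \<subseteq> pverts G"
  shows "minimal_ve_dominating_set (relabel f G) (f ` D) \<longleftrightarrow> minimal_ve_dominating_set G D"
proof -
  have "(\<forall>D'. D' \<subset> f ` D \<longrightarrow> \<not> ve_dominating_set (relabel f G) D') \<longleftrightarrow>
      (\<forall>D'. D' \<subset> D \<longrightarrow> \<not> ve_dominating_set G D')" (is "?L \<longleftrightarrow> ?R")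
  proof
    assume L: ?L
    show ?R
    proof (intro allI impI)
      fix D' assume D': "D' \<subset> D"
      then have "f ` D' \<subset> f ` D"
        using inj_on_subset[OF inj D] by (metis inj_on_image_eq_iff inj_on_subset psubset_eq image_mono subset_refl)
      with L D' D ve_dominating_set_relabel[of D'] show "\<not> ve_dominating_set G D'" by blast
    qed
  next
    assume R: ?R
    show ?L
    proof (intro allI impI)
      fix D' assume D': "D' \<subset> f ` D"
      then obtain E where E: "E \<subseteq> D" "D' = f ` E" by (meson psubset_imp_subset subset_imageE)
      with D' have "E \<subset> D" by blast
      with R D E ve_dominating_set_relabel[of E] show "\<not> ve_dominating_set (relabel f G) D'" by blast
    qed
  qed
  then show ?thesis
    unfolding minimal_ve_dominating_set_def using ve_dominating_set_relabel[OF D] by blast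
qed

lemma well_ve_dominated_relabel: "well_ve_dominated (relabel f G) \<longleftrightarrow> well_ve_dominated G"
proof -
  have inV: "D \<subseteq> pverts K" if "minimal_ve_dominating_set K D" for K :: "'c pair_pre_digraph" and D
    using that by (simp add: minimal_ve_dominating_set_def ve_dominating_set_def)
  have card: "card (f ` D) = card D" if "D \<subseteq> pverts G" for D
    using inj that by (meson card_image inj_on_subset)
  show ?thesis
  proof
    assume "well_ve_dominated (relabel f G)"
    then have push: "card (f ` D) = card (f ` D')"
      if "minimal_ve_dominating_set G D" "minimal_ve_dominating_set G D'" for D D'
      unfolding well_ve_dominated_def using that minimal_ve_dominating_set_relabel inV by blast
    show "well_ve_dominated G"
      unfolding well_ve_dominated_def
    proof (intro allI impI)
      fix D D' assume D: "minimal_ve_dominating_set G D" "minimal_ve_dominating_set G D'"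
      from push[OF D] show "card D = card D'" unfolding card[OF inV[OF D(1)]] card[OF inV[OF D(2)]] .
    qed
  next
    assume wG: "well_ve_dominated G"
    have pull: "\<exists>E. E \<subseteq> pverts G \<and> D = f ` E \<and> minimal_ve_dominating_set G E"
      if D: "minimal_ve_dominating_set (relabel f G) D" for D
    proof -
      obtain E where "E \<subseteq> pverts G" "D = f ` E"
        using D by (auto simp: minimal_ve_dominating_set_def ve_dominating_set_def subset_image_iff)
      with D minimal_ve_dominating_set_relabel show ?thesis by blast
    qed
    show "well_ve_dominated (relabel f G)"
      unfolding well_ve_dominated_def
    proof (intro allI impI)
      fix D D' assume "minimal_ve_dominating_set (relabel f G) D" "minimal_ve_dominating_set (relabel f G) D'"
      then obtain E E' where E: "E \<subseteq> pverts G" "D = f ` E" "minimal_ve_dominating_set G E"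
          "E' \<subseteq> pverts G" "D' = f ` E'" "minimal_ve_dominating_set G E'"
        using pull by meson
      then have "card E = card E'" using wG unfolding well_ve_dominated_def by blast
      with E show "card D = card D'" by (simp add: card)
    qed
  qed
qed

end

end

lemma tree_graphI: "undirected_tree G \<Longrightarrow> tree_graph G"
  by (simp add: tree_graph_def tree_graph_axioms_def undirected_tree_def)

context tree_graph
begin

lemma finite_vertices: "finite (pverts G)"
  by (rule pair_finite_verts)

lemma wellformed_arcs: "pair_wf_digraph G"
  by (rule pair_wf_digraph)

lemma parcs_one_vertex:
  assumes "pverts G = {x}"
  shows "parcs G = {}"
proof -
  have "(u, v) \<notin> parcs G" for u v
  proof
    assume uv: "(u, v) \<in> parcs G"
    then have "u \<in> {x}" "v \<in> {x}" unfolding assms[symmetric] by (rule wellformed')+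
    with no_loops'[OF uv] show False by simp
  qed
  then show ?thesis by auto
qed

lemma parcs_two_vertices:
  assumes V: "pverts G = {x, y}" and ne: "x \<noteq> y"
  shows "parcs G = {(x, y), (y, x)}"
proof -
  have sub: "u = x \<and> v = y \<or> u = y \<and> v = x" if uv: "(u, v) \<in> parcs G" for u v
  proof -
    from uv have "u \<in> {x, y}" "v \<in> {x, y}" unfolding V[symmetric] by (rule wellformed')+
    with no_loops'[OF uv] show ?thesis by blast
  qed
  have "x \<in> pverts G" "2 \<le> card (pverts G)" using V ne by simp_all
  then obtain z where z: "(x, z) \<in> parcs G" by (rule ex_neighbour)
  with sub[OF z] ne have "(x, y) \<in> parcs G" by simp
  moreover from this have "(y, x) \<in> parcs G" by (rule arcs_symmetric)
  ultimately show ?thesis using sub by auto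
qed

end

lemma path_graph_1: "path_graph 1 = \<lparr> pverts = {0}, parcs = {} \<rparr>"
  by (auto simp: path_graph_def)

lemma path_graph_2: "path_graph 2 = \<lparr> pverts = {0, 1}, parcs = {(0, 1), (1, 0)} \<rparr>"
  by (auto simp: path_graph_def less_2_cases_iff)

lemma well_ve_dominated_path_graph_1: "well_ve_dominated (path_graph 1)"
proof -
  have "ve_dominating_set (path_graph 1) {}"
    unfolding ve_dominating_set_def path_graph_1 by simp
  then have "D = {}" if "minimal_ve_dominating_set (path_graph 1) D" for D
    using that unfolding minimal_ve_dominating_set_def by blast
  then show ?thesis by (metis well_ve_dominated_def)
qed

lemma well_ve_dominated_path_graph_2: "well_ve_dominated (path_graph 2)"
proof -
  have dom: "ve_dominating_set (path_graph 2) D \<longleftrightarrow> D \<subseteq> {0, 1} \<and> D \<noteq> {}" for D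
    by (auto simp: ve_dominating_set_def ve_dominates_def closed_neighborhood_def path_graph_2)
  have "card D = 1" if D: "minimal_ve_dominating_set (path_graph 2) D" for D
  proof -
    obtain x where x: "x \<in> D" "x \<in> {0, 1}"
      using D by (auto simp: minimal_ve_dominating_set_def dom)
    then have "ve_dominating_set (path_graph 2) {x}" by (simp add: dom)
    moreover have "{x} \<subseteq> D" using x by simp
    ultimately have "D = {x}" using D unfolding minimal_ve_dominating_set_def by blast
    then show ?thesis by simp
  qed
  then show ?thesis by (metis well_ve_dominated_def)
qed

text \<open>
  The members of \<open>T_wc\<close> on the right-hand side have natural numbers as vertices, so the tree is
  first copied to \<open>{..<n}\<close>. For \<open>n = 1\<close> and \<open>n = 2\<close> this copy is equal to the path.
\<close>

theorem theorem17:
  fixes T :: "'a pair_pre_digraph"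
  assumes "undirected_tree T"
  shows "well_ve_dominated T \<longleftrightarrow>
    (\<exists>H \<in> T_wc \<union> {path_graph 1, path_graph 2}. digraph_iso (with_proj T) (with_proj H))"
proof -
  have T: "pair_graph T" using assms by (simp add: undirected_tree_def)
  note tT = tree_graphI[OF assms]
  show ?thesis
  proof
    assume well: "well_ve_dominated T"
    define n where "n = card (pverts T)"
    obtain f where f: "bij_betw f (pverts T) {0..<n}"
      using ex_bij_betw_finite_nat[OF tree_graph.finite_vertices[OF tT]] unfolding n_def by blast
    then have inj: "inj_on f (pverts T)" and img: "f ` pverts T = {..<n}"
      by (simp_all add: bij_betw_def lessThan_atLeast0)
    define H where "H = relabel f T"
    have iso: "digraph_iso (with_proj T) (with_proj H)"
      unfolding H_def by (rule pair_graph.digraph_iso_relabel[OF T inj])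
    have treeH: "undirected_tree H"
      unfolding H_def by (rule pair_graph.undirected_tree_relabel[OF T inj assms])
    note tH = tree_graphI[OF treeH]
    have VH: "pverts H = {..<n}" by (simp add: H_def img)
    have wellH: "well_ve_dominated H" using well pair_graph.well_ve_dominated_relabel[OF T inj] by (simp add: H_def)
    have "n \<noteq> 0" using tree_graph.verts_nonempty[OF tH] VH by auto
    then consider "n = 1" | "n = 2" | "3 \<le> n" by linarith
    then have "H \<in> T_wc \<union> {path_graph 1, path_graph 2}"
    proof cases
      case 1
      then have "pverts H = {0}" using VH by auto
      with tree_graph.parcs_one_vertex[OF tH this] have "H = path_graph 1"
        unfolding path_graph_1 by (intro pair_pre_digraph.equality) simp_all
      then show ?thesis by blast
    next
      case 2
      have "{..<2} = {0, 1 :: nat}" by auto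
      then have "pverts H = {0, 1}" unfolding VH 2 .
      with tree_graph.parcs_two_vertices[OF tH this zero_neq_one] have "H = path_graph 2"
        unfolding path_graph_2 by (intro pair_pre_digraph.equality) simp_all
      then show ?thesis by blast
    next
      case 3
      then have "3 \<le> card (pverts H)" by (simp add: VH)
      then obtain C where "star_partition H C"
        by (rule tree_graph.star_partition_if_well_ve_dominated[OF tH wellH])
      then show ?thesis using tree_graph.T_wc_if_star_partition[OF tH] by blast
    qed
    with iso show "\<exists>H \<in> T_wc \<union> {path_graph 1, path_graph 2}. digraph_iso (with_proj T) (with_proj H)"
      by blast
  next
    assume "\<exists>H \<in> T_wc \<union> {path_graph 1, path_graph 2}. digraph_iso (with_proj T) (with_proj H)"
    then obtain H where H: "H \<in> T_wc \<union> {path_graph 1, path_graph 2}"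
      and iso: "digraph_iso (with_proj T) (with_proj H)" by blast
    obtain f where f: "inj_on f (pverts T)" "H = relabel f T"
      using digraph_iso_imp_relabel[OF tree_graph.wellformed_arcs[OF tT] iso] .
    have "well_ve_dominated H"
    proof (cases "H \<in> T_wc")
      case True
      then obtain C where C: "star_partition H C" by (rule star_partition_if_T_wc)
      have treeH: "undirected_tree H" using True by (auto simp: T_wc_def)
      show ?thesis by (rule tree_graph.well_ve_dominated_if_star_partition[OF tree_graphI[OF treeH] C])
    next
      case False
      with H show ?thesis using well_ve_dominated_path_graph_1 well_ve_dominated_path_graph_2 by auto
    qed
    then show "well_ve_dominated T" using pair_graph.well_ve_dominated_relabel[OF T f(1)] f(2) by simp
  qed
qed

end
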